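(* Let $u_h:[0,\infty)\to X_h$ be the solution of the semidiscrete problem $$(u_h'',v)+\beta\,a_h(u_h',v)+\alpha(u_h',v)+a_h(u_h,v)=0\quad\forall v\in X_h,\qquad u_h(0)=u_{0h},\ u_h'(0)=u_{1h},$$ with $u_{0h},u_{1h}\in X_h$, and let $E_{(A_h)}(u_h)(t)=\frac12\left(|u_h'(t)|_1^2+|u_h(t)|_{2,h}^2\right)$, where $|\chi_h|_{2,h}=\|A_h\chi_h\|$. Let $0<\delta\le\min\left(\frac{\alpha+\beta\lambda_1}{2},\frac{\lambda_1}{\alpha+\beta\lambda_1}\right)$. Then the following hold for all $t\ge0$. (i) If $0<\delta<\min\left(\frac{\alpha+\beta\lambda_1}{2},\frac{\lambda_1}{\alpha+\beta\lambda_1}\right)$ or $0<\delta=\frac{\alpha+\beta\lambda_1}{2}$, then there is a constant $C=C(\alpha,\beta,\lambda_1)>0$, independent of $h$, $t$ and the initial data, such that $$E_{(A_h)}(u_h)(t)\le C\,e^{-2\delta t}E_{(A_h)}(u_h)(0).$$ (ii) If $0<\delta=\frac{\lambda_1}{\alpha+\beta\lambda_1}$, then there is a constant $C>0$, independent of $h$, $t$ and the initial data, such that $$|u_h'(t)|_1^2\le C\,e^{-2\delta t}E_{(A_h)}(u_h)(0).$$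
   Context: $\Omega\subset\mathbb{R}^d$ is a bounded domain; $\|\cdot\|$, $(\cdot,\cdot)$ are the $L^2(\Omega)$ norm and inner product; $A=-\Delta$ with domain $H^2(\Omega)\cap H_0^1(\Omega)$, $\lambda_1>0$ its smallest eigenvalue, so $\|v\|^2\le\lambda_1^{-1}\|A^{1/2}v\|^2$ for $v\in H_0^1(\Omega)$; $|v|_1=\|A^{1/2}v\|=\|\nabla v\|$. The damping parameters are constants with ($\alpha>0$, $\beta\ge0$) or ($\alpha\ge0$, $\beta>0$). $X_h\subset H_0^1(\Omega)$ is a finite-dimensional (finite element) subspace associated with a shape regular triangulation of $\bar\Omega$ of mesh size $h$, satisfying $\inf_{\psi_h\in X_h}\{\|\psi-\psi_h\|+h\|\psi-\psi_h\|_1\}\le Ch^2\|\psi\|_2$ for all $\psi\in H^2(\Omega)\cap H_0^1(\Omega)$. The bilinear form is $a_h(w_h,\chi_h)=(A^{1/2}w_h,A^{1/2}\chi_h)=(A_hw_h,\chi_h)$ for $w_h,\chi_h\in X_h$, which defines $A_h:X_h\to X_h$; so $\|A_h^{1/2}\chi_h\|=|\chi_h|_1$. Primes denote time derivatives. *)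

theory Defs
  imports "HOL-Analysis.Analysis"
begin

section \<open>The space of square integrable functions\<close>

text \<open>Elements of \<open>L\<^sup>2(\<Omega>)\<close> are represented by functions on the ambient Euclidean space. Only
  their values on \<open>\<Omega>\<close>, up to a null set, matter in the definitions below.\<close>

definition bounded_domain :: "'a::euclidean_space set \<Rightarrow> bool" where
  "bounded_domain \<Omega> \<longleftrightarrow> open \<Omega> \<and> connected \<Omega> \<and> bounded \<Omega> \<and> \<Omega> \<noteq> {}"

definition L2 :: "'a::euclidean_space set \<Rightarrow> ('a \<Rightarrow> real) set" where
  "L2 \<Omega> = {f \<in> borel_measurable (lebesgue_on \<Omega>). integrable (lebesgue_on \<Omega>) (\<lambda>x. (f x)\<^sup>2)}"

definition L2_inner :: "'a::euclidean_space set \<Rightarrow> ('a \<Rightarrow> real) \<Rightarrow> ('a \<Rightarrow> real) \<Rightarrow> real" where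
  "L2_inner \<Omega> f g = (LINT x|lebesgue_on \<Omega>. f x * g x)"

definition L2_norm :: "'a::euclidean_space set \<Rightarrow> ('a \<Rightarrow> real) \<Rightarrow> real" where
  "L2_norm \<Omega> f = sqrt (L2_inner \<Omega> f f)"


section \<open>Weak derivatives and Sobolev spaces\<close>

fun Ck_fun :: "nat \<Rightarrow> ('a::euclidean_space \<Rightarrow> real) \<Rightarrow> bool" where
  "Ck_fun 0 f \<longleftrightarrow> continuous_on UNIV f"
| "Ck_fun (Suc k) f \<longleftrightarrow> (\<forall>x. f differentiable (at x)) \<and>
     (\<forall>b\<in>Basis. Ck_fun k (\<lambda>x. frechet_derivative f (at x) b))"

definition test_fun :: "'a::euclidean_space set \<Rightarrow> ('a \<Rightarrow> real) \<Rightarrow> bool" where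
  "test_fun \<Omega> \<phi> \<longleftrightarrow> (\<forall>k. Ck_fun k \<phi>) \<and>
     compact (closure {x. \<phi> x \<noteq> 0}) \<and> closure {x. \<phi> x \<noteq> 0} \<subseteq> \<Omega>"

definition has_weak_deriv ::
    "'a::euclidean_space set \<Rightarrow> 'a \<Rightarrow> ('a \<Rightarrow> real) \<Rightarrow> ('a \<Rightarrow> real) \<Rightarrow> bool" where
  "has_weak_deriv \<Omega> b f g \<longleftrightarrow> g \<in> L2 \<Omega> \<and>
     (\<forall>\<phi>. test_fun \<Omega> \<phi> \<longrightarrow>
        L2_inner \<Omega> f (\<lambda>x. frechet_derivative \<phi> (at x) b) = - L2_inner \<Omega> g \<phi>)"

text \<open>The weak derivative is unique up to null sets, so the choice of representative is immaterial.\<close>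

definition weak_deriv :: "'a::euclidean_space set \<Rightarrow> 'a \<Rightarrow> ('a \<Rightarrow> real) \<Rightarrow> 'a \<Rightarrow> real" where
  "weak_deriv \<Omega> b f = (SOME g. has_weak_deriv \<Omega> b f g)"

definition H1 :: "'a::euclidean_space set \<Rightarrow> ('a \<Rightarrow> real) set" where
  "H1 \<Omega> = {f \<in> L2 \<Omega>. \<forall>b\<in>Basis. \<exists>g. has_weak_deriv \<Omega> b f g}"

definition H1_norm :: "'a::euclidean_space set \<Rightarrow> ('a \<Rightarrow> real) \<Rightarrow> real" where
  "H1_norm \<Omega> f = sqrt ((L2_norm \<Omega> f)\<^sup>2 + (\<Sum>b\<in>Basis. (L2_norm \<Omega> (weak_deriv \<Omega> b f))\<^sup>2))"

definition H10 :: "'a::euclidean_space set \<Rightarrow> ('a \<Rightarrow> real) set" where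
  "H10 \<Omega> = {f \<in> H1 \<Omega>. \<exists>\<phi>. (\<forall>n::nat. test_fun \<Omega> (\<phi> n)) \<and>
      (\<lambda>n. H1_norm \<Omega> (\<lambda>x. \<phi> n x - f x)) \<longlonglongrightarrow> 0}"

definition H2 :: "'a::euclidean_space set \<Rightarrow> ('a \<Rightarrow> real) set" where
  "H2 \<Omega> = {f \<in> H1 \<Omega>. \<forall>b\<in>Basis. weak_deriv \<Omega> b f \<in> H1 \<Omega>}"

definition H2_norm :: "'a::euclidean_space set \<Rightarrow> ('a \<Rightarrow> real) \<Rightarrow> real" where
  "H2_norm \<Omega> f = sqrt ((H1_norm \<Omega> f)\<^sup>2 +
     (\<Sum>b\<in>Basis. \<Sum>c\<in>Basis. (L2_norm \<Omega> (weak_deriv \<Omega> c (weak_deriv \<Omega> b f)))\<^sup>2))"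


section \<open>The Dirichlet Laplacian\<close>

definition neg_laplacian :: "'a::euclidean_space set \<Rightarrow> ('a \<Rightarrow> real) \<Rightarrow> 'a \<Rightarrow> real" where
  "neg_laplacian \<Omega> f = (\<lambda>x. - (\<Sum>b\<in>Basis. weak_deriv \<Omega> b (weak_deriv \<Omega> b f) x))"

definition dirichlet_eigenvalue :: "'a::euclidean_space set \<Rightarrow> real \<Rightarrow> bool" where
  "dirichlet_eigenvalue \<Omega> l \<longleftrightarrow> (\<exists>f \<in> H2 \<Omega> \<inter> H10 \<Omega>.
     \<not> (AE x in lebesgue_on \<Omega>. f x = 0) \<and>
     (AE x in lebesgue_on \<Omega>. neg_laplacian \<Omega> f x = l * f x))"

definition smallest_dirichlet_eigenvalue :: "'a::euclidean_space set \<Rightarrow> real \<Rightarrow> bool" where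
  "smallest_dirichlet_eigenvalue \<Omega> l \<longleftrightarrow>
     dirichlet_eigenvalue \<Omega> l \<and> (\<forall>m. dirichlet_eigenvalue \<Omega> m \<longrightarrow> l \<le> m)"

text \<open>\<open>dirichlet_form\<close> is \<open>(A\<^sup>1\<^sup>/\<^sup>2 v, A\<^sup>1\<^sup>/\<^sup>2 w) = (\<nabla>v, \<nabla>w)\<close>, and \<open>energy_norm\<close> is
  \<open>|v|\<^sub>1 = \<parallel>A\<^sup>1\<^sup>/\<^sup>2 v\<parallel> = \<parallel>\<nabla>v\<parallel>\<close>.\<close>

definition dirichlet_form ::
    "'a::euclidean_space set \<Rightarrow> ('a \<Rightarrow> real) \<Rightarrow> ('a \<Rightarrow> real) \<Rightarrow> real" where
  "dirichlet_form \<Omega> v w = (\<Sum>b\<in>Basis. L2_inner \<Omega> (weak_deriv \<Omega> b v) (weak_deriv \<Omega> b w))"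

definition energy_norm :: "'a::euclidean_space set \<Rightarrow> ('a \<Rightarrow> real) \<Rightarrow> real" where
  "energy_norm \<Omega> v = sqrt (dirichlet_form \<Omega> v v)"


section \<open>Finite element spaces\<close>

definition finite_dim_subspace :: "('a \<Rightarrow> real) set \<Rightarrow> bool" where
  "finite_dim_subspace X \<longleftrightarrow>
     (\<exists>B. finite B \<and> X = range (\<lambda>(c :: ('a \<Rightarrow> real) \<Rightarrow> real) x. \<Sum>\<phi>\<in>B. c \<phi> * \<phi> x))"

text \<open>\<open>h\<close> is the largest element diameter. Shape regularity with constant \<open>\<sigma>\<close> means that every
  element contains a ball of radius at least \<open>1/\<sigma>\<close> times its diameter.\<close>

definition shape_regular_triangulation ::
    "'a::euclidean_space set \<Rightarrow> real \<Rightarrow> real \<Rightarrow> 'a set set \<Rightarrow> bool" where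
  "shape_regular_triangulation \<Omega> \<sigma> h \<T> \<longleftrightarrow>
     triangulation \<T> \<and> (\<forall>T\<in>\<T>. int DIM('a) simplex T) \<and> \<Union>\<T> = closure \<Omega> \<and>
     h = Max (diameter ` \<T>) \<and>
     \<sigma> > 0 \<and> (\<forall>T\<in>\<T>. \<exists>z. cball z (diameter T / \<sigma>) \<subseteq> T)"

text \<open>The constants \<open>\<sigma>\<close> and \<open>c\<close> (shape regularity and approximation) do not depend on \<open>h\<close> in a
  family of finite element spaces. They are parameters here, so that a statement quantified over
  all \<open>h\<close> and \<open>X\<close> after \<open>\<sigma>\<close> and \<open>c\<close> is a statement about all members of such a family. The
  association with the triangulation is that the functions are elementwise polynomial.\<close>

definition finite_element_space ::
    "'a::euclidean_space set \<Rightarrow> real \<Rightarrow> real \<Rightarrow> real \<Rightarrow> ('a \<Rightarrow> real) set \<Rightarrow> bool" where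
  "finite_element_space \<Omega> \<sigma> c h X \<longleftrightarrow>
     finite_dim_subspace X \<and> X \<subseteq> H10 \<Omega> \<and>
     (\<exists>\<T>. shape_regular_triangulation \<Omega> \<sigma> h \<T> \<and>
        (\<forall>v\<in>X. \<forall>T\<in>\<T>. \<exists>p. real_polynomial_function p \<and>
           (AE x in lebesgue_on (T \<inter> \<Omega>). v x = p x))) \<and>
     (\<forall>\<psi> \<in> H2 \<Omega> \<inter> H10 \<Omega>.
        (INF \<psi>h\<in>X. L2_norm \<Omega> (\<lambda>x. \<psi> x - \<psi>h x) + h * H1_norm \<Omega> (\<lambda>x. \<psi> x - \<psi>h x))
          \<le> c * h\<^sup>2 * H2_norm \<Omega> \<psi>)"

text \<open>\<open>A\<^sub>h : X \<rightarrow> X\<close>, determined up to null sets by \<open>(A\<^sub>h w, v) = a\<^sub>h(w, v)\<close> for all \<open>v\<close> in \<open>X\<close>.\<close>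

definition discrete_laplacian ::
    "'a::euclidean_space set \<Rightarrow> ('a \<Rightarrow> real) set \<Rightarrow> ('a \<Rightarrow> real) \<Rightarrow> 'a \<Rightarrow> real" where
  "discrete_laplacian \<Omega> X w =
     (SOME z. z \<in> X \<and> (\<forall>v\<in>X. L2_inner \<Omega> z v = dirichlet_form \<Omega> w v))"

definition discrete_H2_norm ::
    "'a::euclidean_space set \<Rightarrow> ('a \<Rightarrow> real) set \<Rightarrow> ('a \<Rightarrow> real) \<Rightarrow> real" where
  "discrete_H2_norm \<Omega> X w = L2_norm \<Omega> (discrete_laplacian \<Omega> X w)"


section \<open>The semidiscrete problem\<close>

text \<open>Time derivatives are limits of difference quotients in \<open>L\<^sup>2(\<Omega>)\<close> (on a finite-dimensional space
  all norms give the same notion), one-sided at \<open>t = 0\<close>.\<close>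

definition has_time_deriv ::
    "'a::euclidean_space set \<Rightarrow> (real \<Rightarrow> 'a \<Rightarrow> real) \<Rightarrow> (real \<Rightarrow> 'a \<Rightarrow> real) \<Rightarrow> bool" where
  "has_time_deriv \<Omega> u u' \<longleftrightarrow> (\<forall>t\<ge>0.
     ((\<lambda>s. L2_norm \<Omega> (\<lambda>x. (u s x - u t x) / (s - t) - u' t x)) \<longlongrightarrow> 0) (at t within {0..}))"

text \<open>\<open>u\<close> solves the problem and \<open>u'\<close> is its time derivative.\<close>

definition semidiscrete_solution ::
    "'a::euclidean_space set \<Rightarrow> real \<Rightarrow> real \<Rightarrow> ('a \<Rightarrow> real) set \<Rightarrow> ('a \<Rightarrow> real) \<Rightarrow> ('a \<Rightarrow> real) \<Rightarrow>
      (real \<Rightarrow> 'a \<Rightarrow> real) \<Rightarrow> (real \<Rightarrow> 'a \<Rightarrow> real) \<Rightarrow> bool" where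
  "semidiscrete_solution \<Omega> \<alpha> \<beta> X u0 u1 u u' \<longleftrightarrow>
     (\<exists>u''. (\<forall>t\<ge>0. u t \<in> X \<and> u' t \<in> X \<and> u'' t \<in> X) \<and>
        has_time_deriv \<Omega> u u' \<and> has_time_deriv \<Omega> u' u'' \<and>
        (\<forall>t\<ge>0. \<forall>v\<in>X. L2_inner \<Omega> (u'' t) v + \<beta> * dirichlet_form \<Omega> (u' t) v
           + \<alpha> * L2_inner \<Omega> (u' t) v + dirichlet_form \<Omega> (u t) v = 0)) \<and>
     (AE x in lebesgue_on \<Omega>. u 0 x = u0 x) \<and> (AE x in lebesgue_on \<Omega>. u' 0 x = u1 x)"

definition discrete_energy ::
    "'a::euclidean_space set \<Rightarrow> ('a \<Rightarrow> real) set \<Rightarrow>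
      (real \<Rightarrow> 'a \<Rightarrow> real) \<Rightarrow> (real \<Rightarrow> 'a \<Rightarrow> real) \<Rightarrow> real \<Rightarrow> real" where
  "discrete_energy \<Omega> X u u' t =
     1/2 * ((energy_norm \<Omega> (u' t))\<^sup>2 + (discrete_H2_norm \<Omega> X (u t))\<^sup>2)"

end

theory Submission
  imports Defs "HOL-Computational_Algebra.Polynomial"
begin

text \<open>
  Put \<open>m = min ((\<alpha> + \<beta>\<lambda>\<^sub>1)/2) (\<lambda>\<^sub>1/(\<alpha> + \<beta>\<lambda>\<^sub>1))\<close>. Since \<open>exp (-2mt) \<le> exp (-2\<delta>t)\<close> for \<open>\<delta> \<le> m\<close>, it
  suffices to bound the full energy with \<open>\<delta> = m\<close>, which covers both parts with a constant that does
  not depend on \<open>\<delta>\<close>. With \<open>p = u' + \<delta>u\<close>, \<open>B = \<beta>A\<^sub>h + \<alpha> - 2\<delta>\<close> and \<open>k = A\<^sub>h - \<delta>(\<alpha> + \<beta>A\<^sub>h) + \<delta>\<^sup>2\<close> the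
  equation becomes \<open>u' = p - \<delta>u\<close>, \<open>p' = -\<delta>p - Bp - ku\<close>, where \<open>B \<ge> 0\<close> and \<open>k \<ge> \<delta>\<^sup>2\<close> by the choice of \<open>\<delta>\<close>
  and \<open>A\<^sub>h \<ge> \<lambda>\<^sub>1\<close>. The functional
  \<open>V = \<parallel>Bu\<parallel>\<^sup>2/2 + (Bu, p) + \<parallel>p\<parallel>\<^sup>2 + (ku, u) + ((A\<^sub>hp, p) + (A\<^sub>hku, u))/2\<close> satisfies
  \<open>V' = -2\<delta>V - (Bp, p) - (Bku, u) - (A\<^sub>hBp, p) \<le> -2\<delta>V\<close>. The first two terms are needed in the limiting
  case \<open>\<alpha> = 0\<close>, \<open>\<delta> = 1/\<beta>\<close>, where \<open>k = \<delta>\<^sup>2\<close> no longer controls \<open>A\<^sub>h\<close>; with them \<open>V\<close> is equivalent to the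
  energy. Differentiating \<open>V\<close> in time uses an \<open>L\<^sup>2\<close>-orthonormal basis of \<open>X\<^sub>h\<close>, and the bilinearity of
  the Dirichlet form rests on the uniqueness of weak derivatives.
\<close>

section \<open>Test functions approximating boxes\<close>

definition flat_fun :: "(real \<Rightarrow> real) \<Rightarrow> bool" where
  "flat_fun f \<longleftrightarrow> (\<exists>p. f = (\<lambda>x. if x > 0 then poly p (1 / x) * exp (- (1 / x)) else 0))"

lemma poly_exp_neg_tendsto_0: "((\<lambda>y::real. poly p y * exp (- y)) \<longlongrightarrow> 0) at_top"
proof -
  have "((\<lambda>y::real. \<Sum>i\<le>degree p. coeff p i * (y ^ i / exp y)) \<longlongrightarrow> (\<Sum>i\<le>degree p. coeff p i * 0)) at_top"
    by (intro tendsto_sum tendsto_mult tendsto_const tendsto_power_div_exp_0)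
  then show ?thesis
    by (simp add: poly_altdef sum_distrib_right sum_divide_distrib exp_minus field_simps)
qed

text \<open>For \<open>x > 0\<close> and \<open>s = 1 / x\<close> the chain rule gives
  \<open>s^2 * (p s - p' s) * exp (- s)\<close>, which has the same form. At 0 the exponential beats
  every polynomial, so both one-sided difference quotients tend to 0.\<close>

lemma flat_fun_has_derivative:
  assumes "flat_fun f"
  shows "\<exists>f'. flat_fun f' \<and> (\<forall>x. (f has_real_derivative f' x) (at x))"
proof -
  obtain p where f: "f = (\<lambda>x. if x > 0 then poly p (1 / x) * exp (- (1 / x)) else 0)"
    using assms unfolding flat_fun_def by blast
  define f' :: "real \<Rightarrow> real" where
    "f' = (\<lambda>x. if x > 0 then poly ([:0, 0, 1:] * (p - pderiv p)) (1 / x) * exp (- (1 / x)) else 0)"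
  have "(f has_real_derivative f' x) (at x)" for x
  proof -
    consider "x > 0" | "x < 0" | "x = 0" by linarith
    then show ?thesis
    proof cases
      case 1
      have "((\<lambda>x. poly p (1 / x) * exp (- (1 / x))) has_real_derivative f' x) (at x)"
        using 1 unfolding f'_def
        by (auto intro!: derivative_eq_intros DERIV_chain2[OF poly_DERIV]
            simp: field_simps power2_eq_square)
      then show ?thesis
        by (rule has_field_derivative_transform_within_open[of _ _ _ "{0<..}"]) (use 1 in \<open>auto simp: f\<close>)
    next
      case 2
      have "((\<lambda>x. 0::real) has_real_derivative f' x) (at x)"
        using 2 unfolding f'_def by simp
      then show ?thesis
        by (rule has_field_derivative_transform_within_open[of _ _ _ "{..<0}"]) (use 2 in \<open>auto simp: f\<close>)
    next
      case 3
      have "((\<lambda>h. f h / h) \<longlongrightarrow> 0) (at_right 0)"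
      proof -
        \<comment> \<open>The quotient \<open>f h / h\<close> is \<open>s * p s * exp (- s)\<close>
          with \<open>s = 1 / h\<close>; \<open>pCons 0 p\<close> multiplies \<open>p\<close> by its
          variable.\<close>
        have "((\<lambda>h. poly (pCons 0 p) (inverse h) * exp (- inverse h)) \<longlongrightarrow> 0) (at_right (0::real))"
          by (rule filterlim_compose[OF poly_exp_neg_tendsto_0 filterlim_inverse_at_top_right])
        then show ?thesis
          by (rule Lim_transform_eventually)
            (auto simp: f eventually_at_filter inverse_eq_divide)
      qed
      moreover have "((\<lambda>h. f h / h) \<longlongrightarrow> 0) (at_left 0)"
        by (rule Lim_transform_eventually[OF tendsto_const]) (auto simp: f eventually_at_filter)
      ultimately have "((\<lambda>h. f h / h) \<longlongrightarrow> 0) (at 0)"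
        by (rule filterlim_split_at_real[rotated])
      then show ?thesis
        using 3 by (simp add: DERIV_def f f'_def cong: if_cong)
    qed
  qed
  moreover have "flat_fun f'"
    unfolding flat_fun_def f'_def by blast
  ultimately show ?thesis by blast
qed

section \<open>Closure properties of C^k functions\<close>

lemma Ck_fun_const: "Ck_fun k (\<lambda>x. c)"
  by (induction k arbitrary: c) auto

lemma Ck_fun_imp_continuous: "Ck_fun k f \<Longrightarrow> continuous_on UNIV f"
  by (cases k) (auto simp: differentiable_imp_continuous_within continuous_on_eq_continuous_within)

lemma Ck_fun_SucD: "Ck_fun (Suc k) f \<Longrightarrow> Ck_fun k f"
  by (induction k arbitrary: f)
    (auto simp: differentiable_imp_continuous_within continuous_on_eq_continuous_within)

lemma Ck_fun_add:
  assumes "Ck_fun k f" "Ck_fun k g"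
  shows "Ck_fun k (\<lambda>x. f x + g x)"
  using assms
proof (induction k arbitrary: f g)
  case (Suc k)
  have "frechet_derivative (\<lambda>x. f x + g x) (at x) =
      (\<lambda>b. frechet_derivative f (at x) b + frechet_derivative g (at x) b)" for x
    by (rule frechet_derivative_at[symmetric])
      (use Suc.prems in \<open>auto intro!: derivative_eq_intros simp: frechet_derivative_works\<close>)
  with Suc show ?case by auto
qed (auto intro: continuous_intros)

lemma Ck_fun_mult:
  assumes "Ck_fun k f" "Ck_fun k g"
  shows "Ck_fun k (\<lambda>x. f x * g x)"
  using assms
proof (induction k arbitrary: f g)
  case (Suc k)
  have "frechet_derivative (\<lambda>x. f x * g x) (at x) =
      (\<lambda>b. f x * frechet_derivative g (at x) b + frechet_derivative f (at x) b * g x)" for x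
    by (rule frechet_derivative_at[symmetric], rule has_derivative_mult)
      (use Suc.prems in \<open>auto simp: frechet_derivative_works\<close>)
  \<comment> \<open>The product rule keeps undifferentiated factors, and the induction hypothesis
    wants these at order \<open>k\<close> instead of \<open>Suc k\<close>.\<close>
  moreover have "Ck_fun k f" "Ck_fun k g"
    using Suc.prems by (auto intro: Ck_fun_SucD)
  ultimately show ?case
    using Suc by (auto intro!: Ck_fun_add)
qed (auto intro: continuous_intros)

lemma Ck_fun_prod:
  assumes "finite I" "\<And>i. i \<in> I \<Longrightarrow> Ck_fun k (f i)"
  shows "Ck_fun k (\<lambda>x. \<Prod>i\<in>I. f i x)"
  using assms by (induction I rule: finite_induct) (auto intro: Ck_fun_mult Ck_fun_const)

text \<open>A directional derivative is the constant \<open>b \<bullet> v\<close> times another flat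
  function of the same affine argument, so the induction on \<open>k\<close> closes.\<close>

lemma Ck_fun_flat:
  assumes "flat_fun f"
  shows "Ck_fun k (\<lambda>x::'a::euclidean_space. f (x \<bullet> v + s))"
  using assms
proof (induction k arbitrary: f)
  case 0
  then obtain f' where "\<And>x. (f has_real_derivative f' x) (at x)"
    using flat_fun_has_derivative by blast
  then have "continuous_on UNIV f"
    by (meson DERIV_isCont continuous_at_imp_continuous_on)
  then show ?case
    by (auto intro!: continuous_intros intro: continuous_on_compose2[of UNIV f])
next
  case (Suc k)
  then obtain f' where f': "flat_fun f'" "\<And>x. (f has_real_derivative f' x) (at x)"
    using flat_fun_has_derivative by blast
  have D: "((\<lambda>x. f (x \<bullet> v + s)) has_derivative (\<lambda>b. f' (x \<bullet> v + s) * (b \<bullet> v))) (at x)" for x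
    by (rule has_derivative_compose[of "\<lambda>x. x \<bullet> v + s" "\<lambda>b. b \<bullet> v" x UNIV f "\<lambda>y. f' (x \<bullet> v + s) * y"])
      (use f'(2)[of "x \<bullet> v + s"] in \<open>auto intro!: derivative_eq_intros simp: has_field_derivative_def\<close>)
  show ?case
    using D f'(1) Suc.IH frechet_derivative_at[OF D, symmetric]
    by (auto simp: differentiable_def intro!: Ck_fun_mult Ck_fun_const)
qed

lemma flat_fun_exp: "flat_fun (\<lambda>x. if x > 0 then exp (- (1 / x)) else 0)"
  unfolding flat_fun_def by (intro exI[of _ 1]) auto

text \<open>The test functions \<open>\<Prod>\<^sub>b \<psi>(n(x\<^sub>b - c\<^sub>b)) \<psi>(n(d\<^sub>b - x\<^sub>b))\<close> with \<open>\<psi>(s) = exp(-1/s)\<close> for \<open>s > 0\<close>.\<close>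

lemma test_funs_approximate_box:
  fixes \<Omega> :: "'a::euclidean_space set"
  assumes "cbox c d \<subseteq> \<Omega>"
  shows "\<exists>\<phi>. (\<forall>n::nat. test_fun \<Omega> (\<phi> n)) \<and> (\<forall>n x. \<bar>\<phi> n x\<bar> \<le> 1) \<and>
    (\<forall>x. (\<lambda>n. \<phi> n x) \<longlonglongrightarrow> indicator (box c d) x)"
proof -
  define \<psi> :: "real \<Rightarrow> real" where "\<psi> = (\<lambda>x. if x > 0 then exp (- (1 / x)) else 0)"
  define \<phi> :: "nat \<Rightarrow> 'a \<Rightarrow> real" where
    "\<phi> = (\<lambda>n x. \<Prod>b\<in>Basis. \<psi> (real (Suc n) * (x \<bullet> b - c \<bullet> b)) * \<psi> (real (Suc n) * (d \<bullet> b - x \<bullet> b)))"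
  have \<psi>01: "0 \<le> \<psi> s" "\<psi> s \<le> 1" for s
    unfolding \<psi>_def by auto
  have "Ck_fun k (\<lambda>x::'a. \<psi> (x \<bullet> v + s))" for k v s
    using Ck_fun_flat[OF flat_fun_exp] by (simp add: \<psi>_def)
  note \<psi>_affine = this
  have "Ck_fun k (\<lambda>x::'a. \<psi> (r * (x \<bullet> b - s)))" "Ck_fun k (\<lambda>x::'a. \<psi> (r * (s - x \<bullet> b)))" for k r s b
    using \<psi>_affine[of k "r *\<^sub>R b" "- r * s"] \<psi>_affine[of k "- r *\<^sub>R b" "r * s"]
    by (simp_all add: algebra_simps)
  then have smooth: "Ck_fun k (\<phi> n)" for k n
    unfolding \<phi>_def by (intro Ck_fun_prod finite_Basis Ck_fun_mult)
  have zero: "\<phi> n x = 0" if "x \<notin> box c d" for n x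
  proof -
    obtain b where "b \<in> Basis" "x \<bullet> b \<le> c \<bullet> b \<or> d \<bullet> b \<le> x \<bullet> b"
      using \<open>x \<notin> box c d\<close> by (auto simp: mem_box not_less)
    then have "\<psi> (real (Suc n) * (x \<bullet> b - c \<bullet> b)) * \<psi> (real (Suc n) * (d \<bullet> b - x \<bullet> b)) = 0"
      unfolding \<psi>_def by (auto simp: zero_less_mult_iff)
    then show ?thesis
      unfolding \<phi>_def using \<open>b \<in> Basis\<close> by (intro prod_zero) auto
  qed
  have supp: "closure {x. \<phi> n x \<noteq> 0} \<subseteq> cbox c d" for n
  proof (rule closure_minimal)
    show "{x. \<phi> n x \<noteq> 0} \<subseteq> cbox c d"
      using zero[of _ n] box_subset_cbox[of c d] by (metis (mono_tags, lifting) mem_Collect_eq subset_eq)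
  qed (rule closed_cbox)
  have "test_fun \<Omega> (\<phi> n)" for n
    unfolding test_fun_def
    using smooth supp[of n] assms bounded_subset[OF bounded_cbox supp[of n]]
    by (auto simp: compact_eq_bounded_closed)
  moreover have "\<bar>\<phi> n x\<bar> \<le> 1" for n x
  proof -
    have "0 \<le> \<phi> n x" "\<phi> n x \<le> 1"
      unfolding \<phi>_def by (auto intro!: prod_nonneg prod_le_1 mult_nonneg_nonneg mult_le_one \<psi>01)
    then show ?thesis by auto
  qed
  moreover have "(\<lambda>n. \<phi> n x) \<longlonglongrightarrow> indicator (box c d) x" for x
  proof (cases "x \<in> box c d")
    case True
    \<comment> \<open>Inside the box every factor is \<open>exp (- 1 / (n s))\<close> with
      \<open>s > 0\<close> and so tends to 1. Using \<open>Suc n\<close> keeps the argument positive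
      for every index.\<close>
    have lim: "(\<lambda>n. \<psi> (real (Suc n) * s)) \<longlonglongrightarrow> 1" if "s > 0" for s
    proof -
      have "(\<lambda>n. exp (- (inverse s * inverse (real (Suc n))))) \<longlonglongrightarrow> exp (- (inverse s * 0))"
        by (intro tendsto_intros LIMSEQ_inverse_real_of_nat)
      moreover have "\<psi> (real (Suc n) * s) = exp (- (inverse s * inverse (real (Suc n))))" for n
      proof -
        have "real (Suc n) * s > 0" using that by simp
        then show ?thesis by (simp add: \<psi>_def divide_inverse mult.commute)
      qed
      ultimately show ?thesis by simp
    qed
    have "(\<lambda>n. \<phi> n x) \<longlonglongrightarrow> (\<Prod>b\<in>(Basis::'a set). 1 * 1)"
      unfolding \<phi>_def using True
      by (intro tendsto_prod tendsto_mult lim) (auto simp: mem_box)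
    then show ?thesis using True by simp
  qed (simp add: zero)
  ultimately show ?thesis by blast
qed

section \<open>Square integrable functions\<close>

lemma L2_measurable: "f \<in> L2 \<Omega> \<Longrightarrow> f \<in> borel_measurable (lebesgue_on \<Omega>)"
  by (simp add: L2_def)

lemma integrable_mult_L2:
  assumes "f \<in> L2 \<Omega>" "g \<in> L2 \<Omega>"
  shows "integrable (lebesgue_on \<Omega>) (\<lambda>x. f x * g x)"
proof (rule Bochner_Integration.integrable_bound)
  show "integrable (lebesgue_on \<Omega>) (\<lambda>x. (f x)\<^sup>2 + (g x)\<^sup>2)"
    using assms by (intro Bochner_Integration.integrable_add) (auto simp: L2_def)
  show "(\<lambda>x. f x * g x) \<in> borel_measurable (lebesgue_on \<Omega>)"
    using assms by (intro borel_measurable_times L2_measurable)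
  have "\<bar>r * s\<bar> \<le> r\<^sup>2 + s\<^sup>2" for r s :: real
  proof -
    have "2 * (\<bar>r\<bar> * \<bar>s\<bar>) \<le> r\<^sup>2 + s\<^sup>2" "0 \<le> \<bar>r\<bar> * \<bar>s\<bar>"
      using sum_squares_bound[of "\<bar>r\<bar>" "\<bar>s\<bar>"] by (simp_all add: mult.assoc)
    then show ?thesis unfolding abs_mult by linarith
  qed
  then show "AE x in lebesgue_on \<Omega>. norm (f x * g x) \<le> norm ((f x)\<^sup>2 + (g x)\<^sup>2)"
    by simp
qed

lemma measurable_mult_L2:
  "f \<in> L2 \<Omega> \<Longrightarrow> g \<in> L2 \<Omega> \<Longrightarrow> (\<lambda>x. f x * g x) \<in> borel_measurable (lebesgue_on \<Omega>)"
  by (rule borel_measurable_integrable[OF integrable_mult_L2])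

lemma L2_lincomb:
  assumes "f \<in> L2 \<Omega>" "g \<in> L2 \<Omega>"
  shows "(\<lambda>x. a * f x + b * g x) \<in> L2 \<Omega>"
proof -
  have "integrable (lebesgue_on \<Omega>) (\<lambda>x. a\<^sup>2 * (f x * f x) + b\<^sup>2 * (g x * g x) + 2 * a * b * (f x * g x))"
    by (intro Bochner_Integration.integrable_add integrable_mult_right integrable_mult_L2 assms)
  also have "(\<lambda>x. a\<^sup>2 * (f x * f x) + b\<^sup>2 * (g x * g x) + 2 * a * b * (f x * g x)) =
      (\<lambda>x. (a * f x + b * g x)\<^sup>2)"
    by (simp add: power2_eq_square algebra_simps)
  finally have "integrable (lebesgue_on \<Omega>) (\<lambda>x. (a * f x + b * g x)\<^sup>2)" .
  then show ?thesis
    unfolding L2_def using assms[THEN L2_measurable]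
    by (auto intro!: borel_measurable_add borel_measurable_times)
qed

lemma L2_inner_commute: "L2_inner \<Omega> f g = L2_inner \<Omega> g f"
  by (simp add: L2_inner_def mult.commute)

lemma L2_inner_lincomb_left:
  assumes "f \<in> L2 \<Omega>" "g \<in> L2 \<Omega>" "h \<in> L2 \<Omega>"
  shows "L2_inner \<Omega> (\<lambda>x. a * f x + b * g x) h = a * L2_inner \<Omega> f h + b * L2_inner \<Omega> g h"
  using integrable_mult_L2[OF assms(1,3)] integrable_mult_L2[OF assms(2,3)]
  unfolding L2_inner_def by (simp add: distrib_right mult.assoc)

lemma L2_inner_nonneg: "L2_inner \<Omega> f f \<ge> 0"
  unfolding L2_inner_def by (intro integral_nonneg_AE) auto

lemma L2_norm_squared: "(L2_norm \<Omega> f)\<^sup>2 = L2_inner \<Omega> f f"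
  by (simp add: L2_norm_def L2_inner_nonneg)

lemma L2_norm_nonneg: "L2_norm \<Omega> f \<ge> 0"
  by (simp add: L2_norm_def L2_inner_nonneg)

lemma L2_inner_AE_cong:
  assumes "AE x in lebesgue_on \<Omega>. f x = g x" "f \<in> L2 \<Omega>" "g \<in> L2 \<Omega>" "h \<in> L2 \<Omega>"
  shows "L2_inner \<Omega> f h = L2_inner \<Omega> g h"
  unfolding L2_inner_def
  by (rule integral_cong_AE)
    (use assms in \<open>auto intro!: measurable_mult_L2\<close>)

lemma L2_inner_eq_0_iff:
  assumes "f \<in> L2 \<Omega>"
  shows "L2_inner \<Omega> f f = 0 \<longleftrightarrow> (AE x in lebesgue_on \<Omega>. f x = 0)"
  unfolding L2_inner_def
  by (subst integral_nonneg_eq_0_iff_AE) (auto intro: integrable_mult_L2 assms)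

text \<open>The quadratic form \<open>(s f + t g, s f + t g)\<close> is nonnegative. On functions,
  as opposed to classes, the form is only semidefinite, which is why \<open>r = 0\<close> is a case
  of its own.\<close>

lemma L2_Cauchy_Schwarz:
  assumes "f \<in> L2 \<Omega>" "g \<in> L2 \<Omega>"
  shows "\<bar>L2_inner \<Omega> f g\<bar> \<le> L2_norm \<Omega> f * L2_norm \<Omega> g"
proof -
  define p q r where "p = L2_inner \<Omega> f f" and "q = L2_inner \<Omega> f g" and "r = L2_inner \<Omega> g g"
  have quad: "0 \<le> s * s * p + 2 * s * t * q + t * t * r" for s t
  proof -
    have in_L2: "(\<lambda>x. s * f x + t * g x) \<in> L2 \<Omega>" using assms by (rule L2_lincomb)
    have "L2_inner \<Omega> (\<lambda>x. s * f x + t * g x) (\<lambda>x. s * f x + t * g x) =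
        s * L2_inner \<Omega> f (\<lambda>x. s * f x + t * g x) + t * L2_inner \<Omega> g (\<lambda>x. s * f x + t * g x)"
      by (rule L2_inner_lincomb_left[OF assms in_L2])
    also have "\<dots> = s * L2_inner \<Omega> (\<lambda>x. s * f x + t * g x) f + t * L2_inner \<Omega> (\<lambda>x. s * f x + t * g x) g"
      by (simp only: L2_inner_commute[of \<Omega> f] L2_inner_commute[of \<Omega> g])
    also have "\<dots> = s * s * p + 2 * s * t * q + t * t * r"
      using L2_inner_commute[of \<Omega> g f]
      by (simp add: L2_inner_lincomb_left assms p_def q_def r_def algebra_simps)
    finally show ?thesis using L2_inner_nonneg[of \<Omega> "\<lambda>x. s * f x + t * g x"] by simp
  qed
  have "r \<ge> 0" "p \<ge> 0" by (simp_all add: r_def p_def L2_inner_nonneg)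
  have "q\<^sup>2 \<le> p * r"
  proof (cases "r = 0")
    case True
    have "q = 0"
    proof (rule ccontr)
      assume "q \<noteq> 0"
      \<comment> \<open>For \<open>r = 0\<close> these values of \<open>s\<close> and
        \<open>t\<close> make the quadratic expression equal to -1.\<close>
      with quad[of 1 "- (p + 1) / (2 * q)"] True show False by (simp add: field_simps)
    qed
    with True show ?thesis by simp
  next
    case False
    have "0 \<le> r * (p * r - q\<^sup>2)"
      \<comment> \<open>At \<open>s = r\<close>, \<open>t = - q\<close> the quadratic expression is
        \<open>r * (p * r - q^2)\<close>.\<close>
      using quad[of r "- q"] by (simp add: algebra_simps power2_eq_square)
    with False \<open>r \<ge> 0\<close> show ?thesis by (simp add: zero_le_mult_iff)
  qed
  then have "sqrt (q\<^sup>2) \<le> sqrt (p * r)" by (rule real_sqrt_le_mono)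
  then show ?thesis by (simp add: L2_norm_def p_def q_def r_def real_sqrt_mult)
qed

section \<open>Test functions in L^2 and the fundamental lemma of the calculus of variations\<close>

lemma continuous_in_L2:
  assumes "bounded_domain \<Omega>" "continuous_on UNIV f"
  shows "f \<in> L2 \<Omega>"
proof -
  have \<Omega>: "\<Omega> \<in> lmeasurable" "\<Omega> \<in> sets lebesgue"
    using assms(1) by (auto simp: bounded_domain_def lmeasurable_open)
  have "compact (closure \<Omega>)" using assms(1) by (simp add: bounded_domain_def)
  then have "bounded (f ` closure \<Omega>)"
    by (intro compact_imp_bounded compact_continuous_image)
      (use assms(2) in \<open>auto intro: continuous_on_subset\<close>)
  then obtain K where K: "\<And>x. x \<in> \<Omega> \<Longrightarrow> \<bar>f x\<bar> \<le> K"
    unfolding bounded_iff using closure_subset by fastforce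
  have meas: "f \<in> borel_measurable (lebesgue_on \<Omega>)"
    by (rule continuous_imp_measurable_on_sets_lebesgue)
      (use \<Omega> assms(2) in \<open>auto intro: continuous_on_subset\<close>)
  have "integrable (lebesgue_on \<Omega>) (\<lambda>x. (f x)\<^sup>2)"
  proof (rule finite_measure.integrable_const_bound)
    show "finite_measure (lebesgue_on \<Omega>)"
      using \<Omega> by (simp add: finite_measure_lebesgue_on)
    show "AE x in lebesgue_on \<Omega>. norm ((f x)\<^sup>2) \<le> K\<^sup>2"
      using K by (intro AE_I2) (auto simp: abs_le_square_iff[symmetric] space_restrict_space intro: order_trans[OF _ abs_ge_self])
  qed (use meas in auto)
  with meas show ?thesis by (simp add: L2_def)
qed

lemma test_fun_in_L2:
  assumes "bounded_domain \<Omega>" "test_fun \<Omega> \<phi>"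
  shows "\<phi> \<in> L2 \<Omega>" "b \<in> Basis \<Longrightarrow> (\<lambda>x. frechet_derivative \<phi> (at x) b) \<in> L2 \<Omega>"
proof -
  have "Ck_fun (Suc 0) \<phi>" using assms(2) by (simp add: test_fun_def del: Ck_fun.simps)
  then show "\<phi> \<in> L2 \<Omega>" "b \<in> Basis \<Longrightarrow> (\<lambda>x. frechet_derivative \<phi> (at x) b) \<in> L2 \<Omega>"
    using assms(1) Ck_fun_imp_continuous[of "Suc 0" \<phi>]
    by (auto intro!: continuous_in_L2)
qed

text \<open>Testing against approximations of box indicators kills all box averages, and the averages
  converge to the function almost everywhere.\<close>

lemma orthogonal_test_funs_AE_0:
  fixes \<Omega> :: "'a::euclidean_space set"
  assumes \<Omega>: "bounded_domain \<Omega>" and g: "g \<in> L2 \<Omega>"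
    and orth: "\<And>\<phi>. test_fun \<Omega> \<phi> \<Longrightarrow> L2_inner \<Omega> g \<phi> = 0"
  shows "AE x in lebesgue_on \<Omega>. g x = 0"
proof -
  have op: "open \<Omega>" and \<Omega>_sets: "\<Omega> \<in> sets lebesgue"
    using \<Omega> by (auto simp: bounded_domain_def)
  have int_g: "integrable (lebesgue_on \<Omega>) g"
    using integrable_mult_L2[OF g continuous_in_L2[OF \<Omega>, of "\<lambda>x. 1"]] by simp
  \<comment> \<open>Extension by zero, so that integrals over cubes and the differentiation theorem
    on the whole space apply.\<close>
  define f where "f = (\<lambda>x. indicator \<Omega> x * g x)"
  have int_f: "integrable lebesgue f"
    using int_g \<Omega>_sets by (simp add: integrable_restrict_space f_def set_integrable_def)
  then have int_box: "f integrable_on cbox a b" for a b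
    by (meson integrable_on_lebesgue integrable_on_subcbox subset_UNIV)
  have box_0: "integral (cbox c d) f = 0" if cd: "cbox c d \<subseteq> \<Omega>" for c d
  proof -
    obtain \<phi> where \<phi>: "\<And>n::nat. test_fun \<Omega> (\<phi> n)" "\<And>n x. \<bar>\<phi> n x\<bar> \<le> 1"
      "\<And>x. (\<lambda>n. \<phi> n x) \<longlonglongrightarrow> indicator (box c d) x"
      using test_funs_approximate_box[OF cd] by blast
    \<comment> \<open>The approximants are bounded by 1, hence \<open>\<bar>g x\<bar>\<close> is a
      majorant; it is integrable because the domain has finite measure.\<close>
    have "(\<lambda>n. L2_inner \<Omega> g (\<phi> n)) \<longlonglongrightarrow> (LINT x|lebesgue_on \<Omega>. g x * indicator (box c d) x)"
      unfolding L2_inner_def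
    proof (rule integral_dominated_convergence)
      show "integrable (lebesgue_on \<Omega>) (\<lambda>x. \<bar>g x\<bar>)" using int_g by simp
      show "AE x in lebesgue_on \<Omega>. (\<lambda>n. g x * \<phi> n x) \<longlonglongrightarrow> g x * indicator (box c d) x"
        using \<phi>(3) by (auto intro!: tendsto_mult)
      show "AE x in lebesgue_on \<Omega>. norm (g x * \<phi> n x) \<le> \<bar>g x\<bar>" for n
        using \<phi>(2) by (auto simp: abs_mult intro!: mult_left_le)
      show "(\<lambda>x. g x * \<phi> n x) \<in> borel_measurable (lebesgue_on \<Omega>)" for n
        by (intro measurable_mult_L2 g test_fun_in_L2(1)[OF \<Omega> \<phi>(1)])
      have "indicator (box c d) \<in> borel_measurable (lebesgue_on \<Omega>)"
        by (intro measurable_restrict_space1 borel_measurable_indicator) simp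
      then show "(\<lambda>x. g x * indicator (box c d) x) \<in> borel_measurable (lebesgue_on \<Omega>)"
        by (intro borel_measurable_times L2_measurable[OF g])
    qed
    then have "(LINT x|lebesgue_on \<Omega>. g x * indicator (box c d) x) = 0"
      using orth[OF \<phi>(1)] by (simp add: LIMSEQ_const_iff)
    also have "(LINT x|lebesgue_on \<Omega>. g x * indicator (box c d) x) =
        (LINT x:box c d|lebesgue. f x)"
      unfolding set_lebesgue_integral_def using \<Omega>_sets
      by (subst integral_restrict_space) (simp_all add: f_def mult_ac)
    also have "\<dots> = integral (box c d) f"
      using integrable_mult_indicator[OF _ int_f, of "box c d"]
      by (intro set_lebesgue_integral_eq_integral) (simp add: set_integrable_def)
    finally show ?thesis by (simp add: integral_open_interval)
  qed
  \<comment> \<open>Lebesgue differentiation: off a null set the averages over cubes with lower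
    corner \<open>x\<close> converge to \<open>f x\<close>.\<close>
  obtain N where N: "negligible N"
    "\<And>x e. \<lbrakk>x \<notin> N; 0 < e\<rbrakk> \<Longrightarrow> \<exists>d>0. \<forall>h. 0 < h \<and> h < d \<longrightarrow>
        norm (integral (cbox x (x + h *\<^sub>R One)) f /\<^sub>R h ^ DIM('a) - f x) < e"
    using integrable_ccontinuous_explicit[OF int_box] by blast
  have "g x = 0" if x: "x \<in> \<Omega>" "x \<notin> N" for x
  proof (rule ccontr)
    assume "g x \<noteq> 0"
    then have "norm (f x) > 0" using x by (simp add: f_def)
    then obtain d where d: "d > 0" "\<And>h. 0 < h \<Longrightarrow> h < d \<Longrightarrow>
        norm (integral (cbox x (x + h *\<^sub>R One)) f /\<^sub>R h ^ DIM('a) - f x) < norm (f x)"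
      using N(2)[OF x(2)] by metis
    obtain e where e: "e > 0" "ball x e \<subseteq> \<Omega>"
      using op x(1) by (auto simp: open_contains_ball)
    \<comment> \<open>The side is below \<open>d\<close>, and the l1 bound on the norm keeps the
      cube within distance \<open>e / 2\<close> of \<open>x\<close>, hence inside the
      domain.\<close>
    define h where "h = min (d / 2) (e / (2 * real DIM('a)))"
    have h: "0 < h" "h < d" "real DIM('a) * h < e"
    proof -
      show "0 < h" "h < d" using d(1) e(1) by (auto simp: h_def)
      have "h \<le> e / (2 * real DIM('a))" by (simp add: h_def)
      then have "real DIM('a) * h \<le> e / 2" by (simp add: field_simps)
      then show "real DIM('a) * h < e" using e(1) by simp
    qed
    have "cbox x (x + h *\<^sub>R One) \<subseteq> ball x e"
    proof
      fix y assume y: "y \<in> cbox x (x + h *\<^sub>R One)"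
      have "norm (y - x) \<le> (\<Sum>b\<in>Basis. \<bar>(y - x) \<bullet> b\<bar>)" by (rule norm_le_l1)
      also have "\<dots> \<le> (\<Sum>b\<in>(Basis::'a set). h)"
      proof (rule sum_mono)
        fix b :: 'a assume "b \<in> Basis"
        with y have "x \<bullet> b \<le> y \<bullet> b" "y \<bullet> b \<le> x \<bullet> b + h"
          by (auto simp: mem_box inner_simps)
        then show "\<bar>(y - x) \<bullet> b\<bar> \<le> h" by (simp add: inner_diff_left)
      qed
      finally show "y \<in> ball x e" using h(3) by (simp add: dist_norm norm_minus_commute)
    qed
    with e(2) have "integral (cbox x (x + h *\<^sub>R One)) f = 0" by (intro box_0) auto
    with d(2)[OF h(1,2)] show False by simp
  qed
  then have "\<forall>x\<in>\<Omega> - N. g x = 0" by auto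
  moreover have "AE x in lebesgue. x \<notin> N"
    using N(1) by (simp add: negligible_iff_null_sets AE_not_in)
  ultimately show ?thesis
    using \<Omega>_sets by (auto simp: AE_restrict_space_iff)
qed

section \<open>Weak derivatives and the Dirichlet form\<close>

text \<open>The difference of two weak derivatives is orthogonal to every test function. This is
  what makes the choice in \<open>weak_deriv\<close> harmless.\<close>

lemma has_weak_deriv_unique:
  assumes "bounded_domain \<Omega>" "has_weak_deriv \<Omega> b f g" "has_weak_deriv \<Omega> b f g'"
  shows "AE x in lebesgue_on \<Omega>. g x = g' x"
proof -
  have L2: "g \<in> L2 \<Omega>" "g' \<in> L2 \<Omega>" using assms by (auto simp: has_weak_deriv_def)
  have "AE x in lebesgue_on \<Omega>. 1 * g x + (- 1) * g' x = 0"
  proof (rule orthogonal_test_funs_AE_0[OF assms(1) L2_lincomb[OF L2]])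
    fix \<phi> assume \<phi>: "test_fun \<Omega> \<phi>"
    then have "L2_inner \<Omega> g \<phi> = L2_inner \<Omega> g' \<phi>"
      using assms(2,3) unfolding has_weak_deriv_def by (metis minus_equation_iff)
    then show "L2_inner \<Omega> (\<lambda>x. 1 * g x + (- 1) * g' x) \<phi> = 0"
      by (subst L2_inner_lincomb_left[OF L2 test_fun_in_L2(1)[OF assms(1) \<phi>]]) simp
  qed
  then show ?thesis by simp
qed

lemma has_weak_deriv_lincomb:
  assumes "bounded_domain \<Omega>" "b \<in> Basis" "f \<in> L2 \<Omega>" "f' \<in> L2 \<Omega>"
    and "has_weak_deriv \<Omega> b f g" "has_weak_deriv \<Omega> b f' g'"
  shows "has_weak_deriv \<Omega> b (\<lambda>x. r * f x + s * f' x) (\<lambda>x. r * g x + s * g' x)"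
  using assms test_fun_in_L2[OF assms(1)]
  by (auto simp: has_weak_deriv_def L2_lincomb L2_inner_lincomb_left)

lemma H1_imp_L2: "f \<in> H1 \<Omega> \<Longrightarrow> f \<in> L2 \<Omega>"
  by (simp add: H1_def)

lemma has_weak_deriv_weak_deriv:
  assumes "f \<in> H1 \<Omega>" "b \<in> Basis"
  shows "has_weak_deriv \<Omega> b f (weak_deriv \<Omega> b f)"
proof -
  have "\<exists>g. has_weak_deriv \<Omega> b f g" using assms by (auto simp: H1_def)
  then show ?thesis unfolding weak_deriv_def by (rule someI_ex)
qed

lemma weak_deriv_in_L2: "f \<in> H1 \<Omega> \<Longrightarrow> b \<in> Basis \<Longrightarrow> weak_deriv \<Omega> b f \<in> L2 \<Omega>"
  using has_weak_deriv_weak_deriv by (auto simp: has_weak_deriv_def)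

lemma H1_lincomb:
  assumes "bounded_domain \<Omega>" "f \<in> H1 \<Omega>" "g \<in> H1 \<Omega>"
  shows "(\<lambda>x. r * f x + s * g x) \<in> H1 \<Omega>"
proof -
  have "\<exists>h. has_weak_deriv \<Omega> b (\<lambda>x. r * f x + s * g x) h" if "b \<in> Basis" for b
    using has_weak_deriv_lincomb[OF assms(1) that _ _ has_weak_deriv_weak_deriv has_weak_deriv_weak_deriv]
      assms(2,3) H1_imp_L2 that by blast
  then show ?thesis
    using assms(2,3) by (simp add: H1_def L2_lincomb)
qed

text \<open>\<open>weak_deriv\<close> picks a representative by \<open>SOME\<close>, so linearity
  can be claimed only almost everywhere; both sides are weak derivatives of the same function, and
  uniqueness applies.\<close>

lemma weak_deriv_lincomb_AE:
  assumes "bounded_domain \<Omega>" "f \<in> H1 \<Omega>" "g \<in> H1 \<Omega>" "b \<in> Basis"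
  shows "AE x in lebesgue_on \<Omega>. weak_deriv \<Omega> b (\<lambda>x. r * f x + s * g x) x =
      r * weak_deriv \<Omega> b f x + s * weak_deriv \<Omega> b g x"
proof (rule has_weak_deriv_unique[OF assms(1)])
  show "has_weak_deriv \<Omega> b (\<lambda>x. r * f x + s * g x) (weak_deriv \<Omega> b (\<lambda>x. r * f x + s * g x))"
    by (intro has_weak_deriv_weak_deriv H1_lincomb assms)
  show "has_weak_deriv \<Omega> b (\<lambda>x. r * f x + s * g x) (\<lambda>x. r * weak_deriv \<Omega> b f x + s * weak_deriv \<Omega> b g x)"
    by (intro has_weak_deriv_lincomb has_weak_deriv_weak_deriv H1_imp_L2 assms)
qed

text \<open>Integrals do not see null sets, so linearity of weak derivatives almost everywhere
  becomes exact linearity of the form.\<close>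

lemma dirichlet_form_lincomb_left:
  assumes "bounded_domain \<Omega>" "f \<in> H1 \<Omega>" "g \<in> H1 \<Omega>" "h \<in> H1 \<Omega>"
  shows "dirichlet_form \<Omega> (\<lambda>x. r * f x + s * g x) h =
      r * dirichlet_form \<Omega> f h + s * dirichlet_form \<Omega> g h"
proof -
  have "L2_inner \<Omega> (weak_deriv \<Omega> b (\<lambda>x. r * f x + s * g x)) (weak_deriv \<Omega> b h) =
      r * L2_inner \<Omega> (weak_deriv \<Omega> b f) (weak_deriv \<Omega> b h) +
      s * L2_inner \<Omega> (weak_deriv \<Omega> b g) (weak_deriv \<Omega> b h)" if b: "b \<in> Basis" for b
  proof -
    have "L2_inner \<Omega> (weak_deriv \<Omega> b (\<lambda>x. r * f x + s * g x)) (weak_deriv \<Omega> b h) =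
        L2_inner \<Omega> (\<lambda>x. r * weak_deriv \<Omega> b f x + s * weak_deriv \<Omega> b g x) (weak_deriv \<Omega> b h)"
      using assms b
      by (intro L2_inner_AE_cong weak_deriv_lincomb_AE weak_deriv_in_L2 L2_lincomb H1_lincomb) auto
    then show ?thesis
      using assms b by (simp add: L2_inner_lincomb_left weak_deriv_in_L2)
  qed
  then show ?thesis
    by (simp add: dirichlet_form_def sum.distrib sum_distrib_left)
qed

lemma dirichlet_form_commute: "dirichlet_form \<Omega> f g = dirichlet_form \<Omega> g f"
  unfolding dirichlet_form_def by (intro sum.cong L2_inner_commute refl)

lemma dirichlet_form_nonneg: "dirichlet_form \<Omega> f f \<ge> 0"
  unfolding dirichlet_form_def by (intro sum_nonneg L2_inner_nonneg)

section \<open>Functions that vanish almost everywhere\<close>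

lemma L2_inner_null:
  assumes "f \<in> L2 \<Omega>" "g \<in> L2 \<Omega>" "L2_inner \<Omega> f f = 0"
  shows "L2_inner \<Omega> f g = 0"
  using L2_Cauchy_Schwarz[OF assms(1,2)] assms(3) by (simp add: L2_norm_def)

text \<open>By definition the weak derivative of a null function is orthogonal to all test functions
  and is therefore null itself. This lets the Dirichlet form pass to classes modulo null functions,
  as coordinate expansions require.\<close>

lemma dirichlet_form_null:
  assumes \<Omega>: "bounded_domain \<Omega>" and f: "f \<in> H1 \<Omega>" and h: "h \<in> H1 \<Omega>"
    and null: "L2_inner \<Omega> f f = 0"
  shows "dirichlet_form \<Omega> f h = 0"
proof -
  have "L2_inner \<Omega> (weak_deriv \<Omega> b f) (weak_deriv \<Omega> b h) = 0" if b: "b \<in> Basis" for b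
  proof -
    have "L2_inner \<Omega> (weak_deriv \<Omega> b f) \<phi> = 0" if \<phi>: "test_fun \<Omega> \<phi>" for \<phi>
    proof -
      have "L2_inner \<Omega> f (\<lambda>x. frechet_derivative \<phi> (at x) b) = 0"
        using H1_imp_L2[OF f] test_fun_in_L2(2)[OF \<Omega> \<phi> b] null by (rule L2_inner_null)
      then show ?thesis
        using has_weak_deriv_weak_deriv[OF f b] \<phi> by (simp add: has_weak_deriv_def)
    qed
    then have "AE x in lebesgue_on \<Omega>. weak_deriv \<Omega> b f x = 0"
      by (intro orthogonal_test_funs_AE_0 \<Omega> weak_deriv_in_L2 f b)
    then have "L2_inner \<Omega> (weak_deriv \<Omega> b f) (weak_deriv \<Omega> b f) = 0"
      by (simp add: L2_inner_eq_0_iff weak_deriv_in_L2 f b)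
    then show ?thesis
      by (rule L2_inner_null[OF weak_deriv_in_L2[OF f b] weak_deriv_in_L2[OF h b]])
  qed
  then show ?thesis by (simp add: dirichlet_form_def)
qed

section \<open>Orthonormal bases of finite-dimensional subspaces\<close>

definition lincomb_closed :: "('a \<Rightarrow> real) set \<Rightarrow> bool" where
  "lincomb_closed X \<longleftrightarrow> (\<lambda>x. 0) \<in> X \<and> (\<forall>f\<in>X. \<forall>g\<in>X. \<forall>r s. (\<lambda>x. r * f x + s * g x) \<in> X)"

definition linear_functional_on :: "('a \<Rightarrow> real) set \<Rightarrow> (('a \<Rightarrow> real) \<Rightarrow> real) \<Rightarrow> bool" where
  "linear_functional_on X F \<longleftrightarrow>
     (\<forall>f\<in>X. \<forall>g\<in>X. \<forall>r s. F (\<lambda>x. r * f x + s * g x) = r * F f + s * F g)"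

lemma lincomb_closed_sum:
  assumes "lincomb_closed X" "finite E" "E \<subseteq> X"
  shows "(\<lambda>x. \<Sum>e\<in>E. c e * e x) \<in> X"
  using assms(2,3)
proof (induction E rule: finite_induct)
  case empty
  then show ?case using assms(1) by (simp add: lincomb_closed_def)
next
  case (insert e E)
  then have "(\<lambda>x. c e * e x + 1 * (\<Sum>e\<in>E. c e * e x)) \<in> X"
    by (intro assms(1)[unfolded lincomb_closed_def, THEN conjunct2, rule_format]) auto
  then show ?case using insert.hyps by simp
qed

lemma linear_functional_on_sum:
  assumes "lincomb_closed X" "linear_functional_on X F" "finite E" "E \<subseteq> X"
  shows "F (\<lambda>x. \<Sum>e\<in>E. c e * e x) = (\<Sum>e\<in>E. c e * F e)"
  using assms(3,4)
proof (induction E rule: finite_induct)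
  case empty
  have "(\<lambda>x. 0) \<in> X" using assms(1) by (simp add: lincomb_closed_def)
  then have "F (\<lambda>x. 0 * (\<lambda>x. 0) x + 0 * (\<lambda>x. 0) x) = 0 * F (\<lambda>x. 0) + 0 * F (\<lambda>x. 0)"
    using assms(2)[unfolded linear_functional_on_def, rule_format, of "\<lambda>x. 0" "\<lambda>x. 0" 0 0] by simp
  then show ?case by simp
next
  case (insert e E)
  have "F (\<lambda>x. c e * e x + 1 * (\<Sum>e\<in>E. c e * e x)) = c e * F e + 1 * F (\<lambda>x. \<Sum>e\<in>E. c e * e x)"
    using insert.prems lincomb_closed_sum[OF assms(1) insert.hyps(1), of c]
    by (intro assms(2)[unfolded linear_functional_on_def, rule_format]) auto
  then show ?case using insert by simp
qed

lemma linear_functional_L2_inner: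
  "X \<subseteq> L2 \<Omega> \<Longrightarrow> y \<in> L2 \<Omega> \<Longrightarrow> linear_functional_on X (\<lambda>f. L2_inner \<Omega> f y)"
  by (auto simp: linear_functional_on_def subset_eq L2_inner_lincomb_left)

lemma linear_functional_dirichlet_form:
  "bounded_domain \<Omega> \<Longrightarrow> X \<subseteq> H1 \<Omega> \<Longrightarrow> y \<in> H1 \<Omega> \<Longrightarrow>
    linear_functional_on X (\<lambda>f. dirichlet_form \<Omega> f y)"
  by (auto simp: linear_functional_on_def subset_eq dirichlet_form_lincomb_left)

lemma finite_dim_subspace_lincomb_closed:
  assumes "finite_dim_subspace X"
  shows "lincomb_closed X"
proof -
  obtain B where X: "X = range (\<lambda>c x. \<Sum>\<phi>\<in>B. c \<phi> * \<phi> x)"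
    using assms by (auto simp: finite_dim_subspace_def)
  have "(\<lambda>x. 0) \<in> X" unfolding X by (rule range_eqI[of _ _ "\<lambda>_. 0"]) simp
  moreover have "(\<lambda>x. r * (\<Sum>\<phi>\<in>B. c \<phi> * \<phi> x) + s * (\<Sum>\<phi>\<in>B. d \<phi> * \<phi> x)) \<in> X" for r s c d
    unfolding X
    by (rule range_eqI[of _ _ "\<lambda>\<phi>. r * c \<phi> + s * d \<phi>"])
      (simp add: sum_distrib_left sum.distrib algebra_simps)
  ultimately show ?thesis
    unfolding lincomb_closed_def by (auto simp: X)
qed

section \<open>Gram-Schmidt orthonormalisation\<close>

definition L2_orthonormal :: "'a::euclidean_space set \<Rightarrow> ('a \<Rightarrow> real) set \<Rightarrow> bool" where
  "L2_orthonormal \<Omega> E \<longleftrightarrow> (\<forall>e\<in>E. \<forall>f\<in>E. L2_inner \<Omega> e f = (if e = f then 1 else 0))"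

text \<open>The conclusion is a Parseval identity instead of a spanning property: with a
  semidefinite product a function is recovered from its coefficients only up to a null
  function.\<close>

lemma Gram_Schmidt_L2:
  assumes "finite B" "B \<subseteq> X" "lincomb_closed X" "X \<subseteq> L2 \<Omega>"
  shows "\<exists>E. finite E \<and> E \<subseteq> X \<and> L2_orthonormal \<Omega> E \<and>
    (\<forall>\<phi>\<in>B. \<forall>y\<in>X. L2_inner \<Omega> \<phi> y = (\<Sum>e\<in>E. L2_inner \<Omega> \<phi> e * L2_inner \<Omega> e y))"
  using assms(1,2)
proof (induction B rule: finite_induct)
  case empty
  then show ?case by (intro exI[of _ "{}"]) (auto simp: L2_orthonormal_def)
next
  case (insert \<phi> B)
  then obtain E where E: "finite E" "E \<subseteq> X" "L2_orthonormal \<Omega> E"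
    and parseval: "\<And>\<psi> y. \<psi> \<in> B \<Longrightarrow> y \<in> X \<Longrightarrow>
      L2_inner \<Omega> \<psi> y = (\<Sum>e\<in>E. L2_inner \<Omega> \<psi> e * L2_inner \<Omega> e y)"
    by auto
  have \<phi>: "\<phi> \<in> X" using insert.prems by simp
  \<comment> \<open>\<open>q\<close> is the projection of \<open>\<phi>\<close> onto the span of
    \<open>E\<close>, and \<open>r\<close> is the residual.\<close>
  define q where "q = (\<lambda>x. \<Sum>e\<in>E. L2_inner \<Omega> \<phi> e * e x)"
  define r where "r = (\<lambda>x. 1 * \<phi> x + (- 1) * q x)"
  have qX: "q \<in> X" unfolding q_def by (intro lincomb_closed_sum assms E)
  have rX: "r \<in> X" using \<phi> qX assms(3) unfolding r_def lincomb_closed_def by blast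
  have X_L2: "y \<in> L2 \<Omega>" if "y \<in> X" for y using that assms(4) by auto
  have r_inner: "L2_inner \<Omega> r y = L2_inner \<Omega> \<phi> y - (\<Sum>e\<in>E. L2_inner \<Omega> \<phi> e * L2_inner \<Omega> e y)"
    if y: "y \<in> X" for y
  proof -
    have "L2_inner \<Omega> q y = (\<Sum>e\<in>E. L2_inner \<Omega> \<phi> e * L2_inner \<Omega> e y)"
      unfolding q_def
      by (rule linear_functional_on_sum[OF assms(3) linear_functional_L2_inner[OF assms(4) X_L2[OF y]] E(1,2)])
    then show ?thesis
      unfolding r_def by (subst L2_inner_lincomb_left) (use \<phi> qX y X_L2 in auto)
  qed
  have r_orth: "L2_inner \<Omega> r e = 0" if e: "e \<in> E" for e
  proof -
    have "(\<Sum>f\<in>E. L2_inner \<Omega> \<phi> f * L2_inner \<Omega> f e) = (\<Sum>f\<in>E. if f = e then L2_inner \<Omega> \<phi> f else 0)"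
      using E(3) e by (intro sum.cong) (auto simp: L2_orthonormal_def)
    then show ?thesis using E e by (subst r_inner) auto
  qed
  show ?case
  proof (cases "L2_inner \<Omega> r r = 0")
    \<comment> \<open>A null residual: \<open>\<phi>\<close> need not lie in the pointwise span of
      \<open>E\<close>, but its inner products with \<open>X\<close> are already accounted
      for.\<close>
    case True
    then have "L2_inner \<Omega> r y = 0" if "y \<in> X" for y
      using L2_inner_null X_L2 rX that by blast
    then have "L2_inner \<Omega> \<phi> y = (\<Sum>e\<in>E. L2_inner \<Omega> \<phi> e * L2_inner \<Omega> e y)" if "y \<in> X" for y
      using r_inner that by simp
    with E parseval show ?thesis by blast
  next
    case False
    define n where "n = L2_norm \<Omega> r"
    have n: "n \<noteq> 0" "n * n = L2_inner \<Omega> r r"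
      using False L2_norm_squared[of \<Omega> r] by (auto simp: n_def power2_eq_square)
    define e0 where "e0 = (\<lambda>x. inverse n * r x + 0 * r x)"
    have e0X: "e0 \<in> X" using rX assms(3) unfolding e0_def lincomb_closed_def by blast
    have e0_inner: "L2_inner \<Omega> e0 y = inverse n * L2_inner \<Omega> r y" if "y \<in> X" for y
      unfolding e0_def by (subst L2_inner_lincomb_left) (use rX that X_L2 in auto)
    have e0_orth: "L2_inner \<Omega> e0 e = 0" "L2_inner \<Omega> e e0 = 0" if "e \<in> E" for e
    proof -
      show "L2_inner \<Omega> e0 e = 0" using e0_inner[of e] r_orth[OF that] E(2) that by auto
      then show "L2_inner \<Omega> e e0 = 0" by (subst L2_inner_commute)
    qed
    have r_e0: "L2_inner \<Omega> r e0 = n"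
    proof -
      have "L2_inner \<Omega> r e0 = inverse n * (n * n)"
        unfolding n(2) by (subst L2_inner_commute) (rule e0_inner[OF rX])
      then show ?thesis using n(1) by simp
    qed
    have e0_1: "L2_inner \<Omega> e0 e0 = 1"
      using e0_inner[OF e0X] r_e0 n by simp
    have "e0 \<notin> E" using e0_1 e0_orth by fastforce
    have "L2_orthonormal \<Omega> (insert e0 E)"
      using E(3) e0_1 e0_orth \<open>e0 \<notin> E\<close> by (auto simp: L2_orthonormal_def)
    moreover have "L2_inner \<Omega> \<psi> y = (\<Sum>e\<in>insert e0 E. L2_inner \<Omega> \<psi> e * L2_inner \<Omega> e y)"
      if "\<psi> \<in> insert \<phi> B" "y \<in> X" for \<psi> y
    proof (cases "\<psi> = \<phi>")
      case True
      \<comment> \<open>\<open>\<phi>\<close> and \<open>r\<close> differ by a combination of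
        \<open>E\<close>, which is orthogonal to \<open>e0\<close>. The new summand
        \<open>n * (r, y) / n\<close> then supplies exactly the missing residual term.\<close>
      have "L2_inner \<Omega> \<phi> e0 = n"
        using r_inner[OF e0X] r_e0 e0_orth by simp
      then show ?thesis
        using True r_inner[OF that(2)] e0_inner[OF that(2)] n(1) \<open>e0 \<notin> E\<close> E(1)
        by (simp add: field_simps)
    next
      case False
      then have "\<psi> \<in> B" using that by simp
      \<comment> \<open>Parseval tested with \<open>e0\<close> shows that an old vector has
        coefficient 0 on \<open>e0\<close>, so the enlarged sum is unchanged.\<close>
      with parseval[OF this e0X] parseval[OF this that(2)] show ?thesis
        using e0_orth \<open>e0 \<notin> E\<close> E(1) by simp
    qed
    ultimately show ?thesis
      using E(1,2) e0X by (intro exI[of _ "insert e0 E"]) auto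
  qed
qed

text \<open>Gram-Schmidt gives Parseval for the generators; linearity in the first argument and an
  exchange of sums extend it to all of \<open>X\<close>.\<close>

lemma L2_orthonormal_basis_exists:
  assumes "finite_dim_subspace X" "X \<subseteq> L2 \<Omega>"
  shows "\<exists>E. finite E \<and> E \<subseteq> X \<and> L2_orthonormal \<Omega> E \<and>
    (\<forall>x\<in>X. \<forall>y\<in>X. L2_inner \<Omega> x y = (\<Sum>e\<in>E. L2_inner \<Omega> x e * L2_inner \<Omega> e y))"
proof -
  obtain B where B: "finite B" and X: "X = range (\<lambda>c x. \<Sum>\<phi>\<in>B. c \<phi> * \<phi> x)"
    using assms(1) by (auto simp: finite_dim_subspace_def)
  have cl: "lincomb_closed X" using assms(1) by (rule finite_dim_subspace_lincomb_closed)
  have "\<phi> \<in> X" if "\<phi> \<in> B" for \<phi>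
    unfolding X
    by (rule range_eqI[of _ _ "\<lambda>\<psi>. if \<psi> = \<phi> then 1 else 0"])
      (use B that in \<open>simp add: if_distrib[of "\<lambda>c. c * _"] cong: if_cong\<close>)
  then have BX: "B \<subseteq> X" by blast
  obtain E where E: "finite E" "E \<subseteq> X" "L2_orthonormal \<Omega> E"
    and parseval: "\<forall>\<phi>\<in>B. \<forall>y\<in>X. L2_inner \<Omega> \<phi> y = (\<Sum>e\<in>E. L2_inner \<Omega> \<phi> e * L2_inner \<Omega> e y)"
    using Gram_Schmidt_L2[OF B BX cl assms(2)] by blast
  have "L2_inner \<Omega> x y = (\<Sum>e\<in>E. L2_inner \<Omega> x e * L2_inner \<Omega> e y)" if x: "x \<in> X" and y: "y \<in> X" for x y
  proof -
    obtain c where c: "x = (\<lambda>z. \<Sum>\<phi>\<in>B. c \<phi> * \<phi> z)" using x X by auto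
    have lin: "L2_inner \<Omega> x z = (\<Sum>\<phi>\<in>B. c \<phi> * L2_inner \<Omega> \<phi> z)" if "z \<in> X" for z
      unfolding c using that assms(2)
      by (intro linear_functional_on_sum[OF cl] linear_functional_L2_inner B BX) auto
    have "L2_inner \<Omega> x y = (\<Sum>\<phi>\<in>B. \<Sum>e\<in>E. c \<phi> * (L2_inner \<Omega> \<phi> e * L2_inner \<Omega> e y))"
      using parseval y by (simp add: lin sum_distrib_left)
    also have "\<dots> = (\<Sum>e\<in>E. \<Sum>\<phi>\<in>B. c \<phi> * (L2_inner \<Omega> \<phi> e * L2_inner \<Omega> e y))"
      by (rule sum.swap)
    also have "\<dots> = (\<Sum>e\<in>E. L2_inner \<Omega> x e * L2_inner \<Omega> e y)"
      using E(2) by (intro sum.cong) (auto simp: lin sum_distrib_right mult.assoc subset_eq)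
    finally show ?thesis .
  qed
  with E show ?thesis by blast
qed

section \<open>The damped system in coordinates\<close>

text \<open>Coordinate vectors are functions on an index type, later the basis functions themselves;
  only values on \<open>E\<close> enter.\<close>

definition dot_on :: "'i set \<Rightarrow> ('i \<Rightarrow> real) \<Rightarrow> ('i \<Rightarrow> real) \<Rightarrow> real" where
  "dot_on E x y = (\<Sum>e\<in>E. x e * y e)"

definition mat_app :: "'i set \<Rightarrow> ('i \<Rightarrow> 'i \<Rightarrow> real) \<Rightarrow> ('i \<Rightarrow> real) \<Rightarrow> 'i \<Rightarrow> real" where
  "mat_app E M x e = (\<Sum>f\<in>E. M e f * x f)"

lemma dot_on_commute: "dot_on E x y = dot_on E y x"
  by (simp add: dot_on_def mult.commute)

lemma dot_on_nonneg: "dot_on E x x \<ge> 0"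
  by (simp add: dot_on_def sum_nonneg)

lemma dot_on_mat_app:
  assumes "\<And>e f. e \<in> E \<Longrightarrow> f \<in> E \<Longrightarrow> M e f = M f e"
  shows "dot_on E x (mat_app E M y) = dot_on E (mat_app E M x) y"
proof -
  have "dot_on E x (mat_app E M y) = (\<Sum>e\<in>E. \<Sum>f\<in>E. x e * (M e f * y f))"
    by (simp add: dot_on_def mat_app_def sum_distrib_left)
  also have "\<dots> = (\<Sum>f\<in>E. \<Sum>e\<in>E. x e * (M e f * y f))"
    by (rule sum.swap)
  also have "\<dots> = dot_on E (mat_app E M x) y"
    unfolding dot_on_def mat_app_def sum_distrib_right
    using assms by (intro sum.cong refl) (simp add: mult_ac)
  finally show ?thesis .
qed

lemma dot_on_has_derivative:
  assumes "\<And>e. e \<in> E \<Longrightarrow> ((\<lambda>s. x s e) has_real_derivative x' e) (at t within S)"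
    and "\<And>e. e \<in> E \<Longrightarrow> ((\<lambda>s. y s e) has_real_derivative y' e) (at t within S)"
  shows "((\<lambda>s. dot_on E (x s) (y s)) has_real_derivative dot_on E x' (y t) + dot_on E (x t) y') (at t within S)"
proof -
  have "((\<lambda>s. \<Sum>e\<in>E. x s e * y s e) has_real_derivative (\<Sum>e\<in>E. x' e * y t e + y' e * x t e)) (at t within S)"
    by (intro DERIV_sum DERIV_mult assms)
  then show ?thesis by (simp add: dot_on_def sum.distrib mult.commute)
qed

lemma mat_app_has_derivative:
  assumes "\<And>e. e \<in> E \<Longrightarrow> ((\<lambda>s. x s e) has_real_derivative x' e) (at t within S)"
  shows "((\<lambda>s. mat_app E M (x s) e) has_real_derivative mat_app E M x' e) (at t within S)"
  unfolding mat_app_def by (intro DERIV_sum DERIV_cmult assms)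

section \<open>The Lyapunov functional and its equivalence with the energy\<close>

text \<open>For a single mode \<open>y'' + (\<alpha> + \<beta>\<mu>) y' + \<mu> y = 0\<close> put \<open>p = y' + \<delta>y\<close>, \<open>B = \<alpha> + \<beta>\<mu> - 2\<delta>\<close> and
  \<open>k = \<mu> - \<delta>(\<alpha> + \<beta>\<mu>) + \<delta>\<^sup>2\<close>. The function below is
  \<open>B\<^sup>2y\<^sup>2/2 + B y p + p\<^sup>2 + k y\<^sup>2 + \<mu> (p\<^sup>2 + k y\<^sup>2)/2\<close>, with \<open>x\<^sub>i\<^sub>j\<close>, \<open>y\<^sub>i\<^sub>j\<close>, \<open>w\<^sub>i\<^sub>j\<close> in place of
  \<open>\<mu>\<^sup>i\<^sup>+\<^sup>j y\<^sup>2\<close>, \<open>\<mu>\<^sup>i\<^sup>+\<^sup>j p\<^sup>2\<close>, \<open>\<mu>\<^sup>i\<^sup>+\<^sup>j y p\<close>.\<close>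

definition lyapunov :: "real \<Rightarrow> real \<Rightarrow> real \<Rightarrow>
    real \<Rightarrow> real \<Rightarrow> real \<Rightarrow> real \<Rightarrow> real \<Rightarrow> real \<Rightarrow> real \<Rightarrow> real" where
  "lyapunov \<alpha> \<beta> \<delta> x00 x01 x11 y00 y01 w00 w10 =
     (\<beta>\<^sup>2 * x11 + 2 * \<beta> * (\<alpha> - 2 * \<delta>) * x01 + (\<alpha> - 2 * \<delta>)\<^sup>2 * x00) / 2
     + \<beta> * w10 + (\<alpha> - 2 * \<delta>) * w00 + y00
     + (1 - \<delta> * \<beta>) * x01 + (\<delta>\<^sup>2 - \<delta> * \<alpha>) * x00
     + (y01 + (1 - \<delta> * \<beta>) * x11 + (\<delta>\<^sup>2 - \<delta> * \<alpha>) * x01) / 2"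

text \<open>Here \<open>q\<close> stands for \<open>(B y + p)\<^sup>2\<close> and \<open>z\<close> for \<open>\<mu> y'\<^sup>2\<close>.\<close>

lemma lyapunov_equiv_energy:
  fixes \<alpha> \<beta> \<delta> l :: real
  assumes "\<alpha> \<ge> 0" "\<beta> \<ge> 0" "l > 0" "\<delta> > 0" "2 * \<delta> \<le> \<alpha> + \<beta> * l" "\<delta> * (\<alpha> + \<beta> * l) \<le> l"
  shows "\<exists>C>0. \<exists>D>0. \<forall>x00 x01 x11 y00 y01 w00 w10 q z.
    0 \<le> x00 \<longrightarrow> 0 \<le> y00 \<longrightarrow> 0 \<le> z \<longrightarrow> 0 \<le> q \<longrightarrow> l * x00 \<le> x01 \<longrightarrow> l * x01 \<le> x11 \<longrightarrow> l * y00 \<le> y01 \<longrightarrow>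
    q = \<beta>\<^sup>2 * x11 + 2 * \<beta> * (\<alpha> - 2 * \<delta>) * x01 + (\<alpha> - 2 * \<delta>)\<^sup>2 * x00 + 2 * \<beta> * w10
      + 2 * (\<alpha> - 2 * \<delta>) * w00 + y00 \<longrightarrow>
    \<beta>\<^sup>2 * x11 \<le> 3 * (q + (\<alpha> - 2 * \<delta>)\<^sup>2 * x00 + y00) \<longrightarrow>
    q \<le> 3 * (\<beta>\<^sup>2 * x11 + (\<alpha> - 2 * \<delta>)\<^sup>2 * x00 + y00) \<longrightarrow>
    z \<le> 2 * y01 + 2 * \<delta>\<^sup>2 * x01 \<longrightarrow> y01 \<le> 2 * z + 2 * \<delta>\<^sup>2 * x01 \<longrightarrow>
    lyapunov \<alpha> \<beta> \<delta> x00 x01 x11 y00 y01 w00 w10 \<le> C * (z + x11) \<and>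
    z + x11 \<le> D * lyapunov \<alpha> \<beta> \<delta> x00 x01 x11 y00 y01 w00 w10"
proof -
  define a \<kappa>\<^sub>1 \<kappa>\<^sub>0 where "a = \<alpha> - 2 * \<delta>" and "\<kappa>\<^sub>1 = 1 - \<delta> * \<beta>" and "\<kappa>\<^sub>0 = \<delta>\<^sup>2 - \<delta> * \<alpha>"
  have \<kappa>\<^sub>1: "\<kappa>\<^sub>1 \<ge> 0" "\<kappa>\<^sub>1 \<le> 1"
  proof -
    have "\<delta> * \<alpha> \<ge> 0" using assms by simp
    then have "(\<delta> * \<beta>) * l \<le> 1 * l" using assms(6) by (simp add: algebra_simps)
    then have "\<delta> * \<beta> \<le> 1" using \<open>l > 0\<close> mult_le_cancel_right_pos by blast
    then show "\<kappa>\<^sub>1 \<ge> 0" "\<kappa>\<^sub>1 \<le> 1" using assms by (simp_all add: \<kappa>\<^sub>1_def)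
  qed
  \<comment> \<open>This is \<open>k \<ge> \<delta>^2\<close> at \<open>\<mu> = l\<close>. Since
    \<open>\<kappa>\<^sub>1 \<ge> 0\<close>, \<open>k\<close> is nondecreasing in
    \<open>\<mu>\<close>, and the bound persists when
    \<open>\<delta> * (\<alpha> + \<beta> * l) = l\<close>.\<close>
  have k_min: "\<delta>\<^sup>2 \<le> \<kappa>\<^sub>1 * l + \<kappa>\<^sub>0"
    using assms(6) by (simp add: \<kappa>\<^sub>1_def \<kappa>\<^sub>0_def algebra_simps)
  define K where "K = (1 / l)"
  have K: "K > 0" using assms by (simp add: K_def)
  \<comment> \<open>A common bound for the coefficients of \<open>x11\<close> and \<open>z\<close>
    computed below; a generous sum avoids a maximum.\<close>
  define C where "C = 3/2 * \<beta>\<^sup>2 + 3/2 * (a\<^sup>2 * K\<^sup>2) + 5 * K + 4 * (\<delta>\<^sup>2 * K * K) + \<bar>\<kappa>\<^sub>0\<bar> * K\<^sup>2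
      + 2 * (\<delta>\<^sup>2 * K) + \<bar>\<kappa>\<^sub>0\<bar> * K + 3"
  \<comment> \<open>\<open>4 + 4\<close> comes from bounding \<open>z\<close> by \<open>y01\<close>
    and \<open>\<delta>^2 * x01\<close>, each at most \<open>2 * V\<close> up to the factor 2; the
    last summand bounds \<open>x11\<close>.\<close>
  define D where "D = 4 + 4 + (if \<beta> = 0 then 2 + 2 * \<bar>\<kappa>\<^sub>0\<bar> / \<delta>\<^sup>2 else 3 * (4 + a\<^sup>2 / \<delta>\<^sup>2) / \<beta>\<^sup>2)"
  have "C > 0"
    unfolding C_def using K by (intro add_nonneg_pos add_nonneg_nonneg mult_nonneg_nonneg) auto
  have "D > 0" unfolding D_def by (simp add: add_pos_nonneg)
  have "lyapunov \<alpha> \<beta> \<delta> x00 x01 x11 y00 y01 w00 w10 \<le> C * (z + x11) \<and>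
      z + x11 \<le> D * lyapunov \<alpha> \<beta> \<delta> x00 x01 x11 y00 y01 w00 w10"
    if h: "0 \<le> x00" "0 \<le> y00" "0 \<le> z" "0 \<le> q" "l * x00 \<le> x01" "l * x01 \<le> x11" "l * y00 \<le> y01"
      and q: "q = \<beta>\<^sup>2 * x11 + 2 * \<beta> * a * x01 + a\<^sup>2 * x00 + 2 * \<beta> * w10 + 2 * a * w00 + y00"
      and q1: "\<beta>\<^sup>2 * x11 \<le> 3 * (q + a\<^sup>2 * x00 + y00)"
      and q2: "q \<le> 3 * (\<beta>\<^sup>2 * x11 + a\<^sup>2 * x00 + y00)"
      and z: "z \<le> 2 * y01 + 2 * \<delta>\<^sup>2 * x01" "y01 \<le> 2 * z + 2 * \<delta>\<^sup>2 * x01"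
    for x00 x01 x11 y00 y01 w00 w10 q z
  proof -
    define V where "V = lyapunov \<alpha> \<beta> \<delta> x00 x01 x11 y00 y01 w00 w10"
    \<comment> \<open>Completing the square absorbs the mixed terms \<open>w00\<close> and
      \<open>w10\<close> into \<open>q / 2\<close> at the cost of half of
      \<open>y00\<close>.\<close>
    have V: "V = q / 2 + y00 / 2 + (\<kappa>\<^sub>1 * x01 + \<kappa>\<^sub>0 * x00) + (y01 + (\<kappa>\<^sub>1 * x11 + \<kappa>\<^sub>0 * x01)) / 2"
      unfolding V_def lyapunov_def q a_def[symmetric] \<kappa>\<^sub>0_def[symmetric] \<kappa>\<^sub>1_def[symmetric]
      by (simp add: field_simps)
    have x01: "0 \<le> x01" using h(1,5) assms(3) by (meson mult_nonneg_nonneg order.strict_implies_order order_trans)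
    have x11: "0 \<le> x11" using x01 h(6) assms(3) by (meson mult_nonneg_nonneg order.strict_implies_order order_trans)
    have y01: "0 \<le> y01" using h(2,7) assms(3) by (meson mult_nonneg_nonneg order.strict_implies_order order_trans)
    have up: "x00 \<le> K * x01" "x01 \<le> K * x11" "y00 \<le> K * y01"
      using h(5-7) assms(3) by (simp_all add: K_def field_simps)
    have x00: "x00 \<le> K\<^sup>2 * x11"
    proof -
      have "K * x01 \<le> K * (K * x11)" using up(2) K by (intro mult_left_mono) auto
      then show ?thesis using up(1) by (simp add: power2_eq_square mult.assoc)
    qed
    have m: "a\<^sup>2 * x00 \<le> a\<^sup>2 * K\<^sup>2 * x11" "\<kappa>\<^sub>1 * x01 \<le> K * x11" "\<kappa>\<^sub>0 * x00 \<le> \<bar>\<kappa>\<^sub>0\<bar> * K\<^sup>2 * x11"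
      "\<kappa>\<^sub>1 * x11 \<le> x11" "\<kappa>\<^sub>0 * x01 \<le> \<bar>\<kappa>\<^sub>0\<bar> * K * x11" "\<delta>\<^sup>2 * x01 \<le> \<delta>\<^sup>2 * K * x11"
    proof -
      show "a\<^sup>2 * x00 \<le> a\<^sup>2 * K\<^sup>2 * x11" using mult_left_mono[OF x00, of "a\<^sup>2"] by (simp add: mult.assoc)
      have "\<kappa>\<^sub>1 * x01 \<le> 1 * x01" using \<kappa>\<^sub>1 x01 by (intro mult_right_mono)
      then show "\<kappa>\<^sub>1 * x01 \<le> K * x11" using up(2) by simp
      show "\<kappa>\<^sub>1 * x11 \<le> x11" using \<kappa>\<^sub>1 x11 mult_right_mono[of \<kappa>\<^sub>1 1 x11] by simp
      have "\<kappa>\<^sub>0 * x00 \<le> \<bar>\<kappa>\<^sub>0\<bar> * x00" using h(1) by (intro mult_right_mono) auto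
      also have "\<dots> \<le> \<bar>\<kappa>\<^sub>0\<bar> * (K\<^sup>2 * x11)" using x00 by (intro mult_left_mono) auto
      finally show "\<kappa>\<^sub>0 * x00 \<le> \<bar>\<kappa>\<^sub>0\<bar> * K\<^sup>2 * x11" by (simp add: mult.assoc)
      have "\<kappa>\<^sub>0 * x01 \<le> \<bar>\<kappa>\<^sub>0\<bar> * x01" using x01 by (intro mult_right_mono) auto
      also have "\<dots> \<le> \<bar>\<kappa>\<^sub>0\<bar> * (K * x11)" using up(2) by (intro mult_left_mono) auto
      finally show "\<kappa>\<^sub>0 * x01 \<le> \<bar>\<kappa>\<^sub>0\<bar> * K * x11" by (simp add: mult.assoc)
      show "\<delta>\<^sup>2 * x01 \<le> \<delta>\<^sup>2 * K * x11" using mult_left_mono[OF up(2), of "\<delta>\<^sup>2"] by (simp add: mult.assoc)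
    qed
    have y00: "y00 \<le> 2 * K * z + 2 * \<delta>\<^sup>2 * K * K * x11"
    proof -
      have "y01 \<le> 2 * z + 2 * (\<delta>\<^sup>2 * K * x11)" using z(2) m(6) by simp
      then have "K * y01 \<le> K * (2 * z + 2 * (\<delta>\<^sup>2 * K * x11))" using K by (intro mult_left_mono) auto
      then show ?thesis using up(3) by (simp add: algebra_simps)
    qed
    have "V \<le> 3/2 * (\<beta>\<^sup>2 * x11) + 3/2 * (a\<^sup>2 * K\<^sup>2 * x11) + 2 * y00 + K * x11 + \<bar>\<kappa>\<^sub>0\<bar> * K\<^sup>2 * x11
        + (y01 + x11 + \<bar>\<kappa>\<^sub>0\<bar> * K * x11) / 2"
      using V q2 m by argo
    also have "\<dots> \<le> 3/2 * (\<beta>\<^sup>2 * x11) + 3/2 * (a\<^sup>2 * K\<^sup>2 * x11) + 2 * (2 * K * z + 2 * \<delta>\<^sup>2 * K * K * x11)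
        + K * x11 + \<bar>\<kappa>\<^sub>0\<bar> * K\<^sup>2 * x11 + (2 * z + 2 * (\<delta>\<^sup>2 * K * x11) + x11 + \<bar>\<kappa>\<^sub>0\<bar> * K * x11) / 2"
      using y00 z(2) m(6) by argo
    also have "\<dots> = (3/2 * \<beta>\<^sup>2 + 3/2 * (a\<^sup>2 * K\<^sup>2) + 4 * (\<delta>\<^sup>2 * K * K) + K + \<bar>\<kappa>\<^sub>0\<bar> * K\<^sup>2 + \<delta>\<^sup>2 * K + 1/2
        + \<bar>\<kappa>\<^sub>0\<bar> * K / 2) * x11 + (4 * K + 1) * z"
      by (simp add: field_simps)
    also have "\<dots> \<le> C * x11 + C * z"
    proof -
      have "0 \<le> \<delta>\<^sup>2 * K" "0 \<le> \<delta>\<^sup>2 * K * K" "0 \<le> \<bar>\<kappa>\<^sub>0\<bar> * K" "0 \<le> \<bar>\<kappa>\<^sub>0\<bar> * K\<^sup>2" "0 \<le> \<beta>\<^sup>2" "0 \<le> a\<^sup>2 * K\<^sup>2"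
        using K by simp_all
      then have "3/2 * \<beta>\<^sup>2 + 3/2 * (a\<^sup>2 * K\<^sup>2) + 4 * (\<delta>\<^sup>2 * K * K) + K + \<bar>\<kappa>\<^sub>0\<bar> * K\<^sup>2 + \<delta>\<^sup>2 * K + 1/2
        + \<bar>\<kappa>\<^sub>0\<bar> * K / 2 \<le> C" "4 * K + 1 \<le> C"
        unfolding C_def using K by linarith+
      then show ?thesis
        using h(3) x11 by (meson add_mono mult_right_mono)
    qed
    also have "\<dots> = C * (z + x11)" by (simp add: distrib_left)
    finally have upper: "V \<le> C * (z + x11)" .
    \<comment> \<open>The bound \<open>k \<ge> \<delta>^2\<close>, once with weight 1 and once with
      weight \<open>\<mu>\<close>.\<close>
    have low: "\<delta>\<^sup>2 * x00 \<le> \<kappa>\<^sub>1 * x01 + \<kappa>\<^sub>0 * x00" "\<delta>\<^sup>2 * x01 \<le> \<kappa>\<^sub>1 * x11 + \<kappa>\<^sub>0 * x01"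
    proof -
      have "\<delta>\<^sup>2 * x00 \<le> (\<kappa>\<^sub>1 * l + \<kappa>\<^sub>0) * x00" using k_min h(1) by (intro mult_right_mono)
      moreover have "\<kappa>\<^sub>1 * (l * x00) \<le> \<kappa>\<^sub>1 * x01" using h(5) \<kappa>\<^sub>1 by (intro mult_left_mono)
      ultimately show "\<delta>\<^sup>2 * x00 \<le> \<kappa>\<^sub>1 * x01 + \<kappa>\<^sub>0 * x00" by (simp add: algebra_simps)
      have "\<delta>\<^sup>2 * x01 \<le> (\<kappa>\<^sub>1 * l + \<kappa>\<^sub>0) * x01" using k_min x01 by (intro mult_right_mono)
      moreover have "\<kappa>\<^sub>1 * (l * x01) \<le> \<kappa>\<^sub>1 * x11" using h(6) \<kappa>\<^sub>1 by (intro mult_left_mono)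
      ultimately show "\<delta>\<^sup>2 * x01 \<le> \<kappa>\<^sub>1 * x11 + \<kappa>\<^sub>0 * x01" by (simp add: algebra_simps)
    qed
    have \<delta>x: "0 \<le> \<delta>\<^sup>2 * x00" "0 \<le> \<delta>\<^sup>2 * x01" using h(1) x01 by simp_all
    have V2: "2 * V = q + y00 + 2 * (\<kappa>\<^sub>1 * x01 + \<kappa>\<^sub>0 * x00) + (y01 + (\<kappa>\<^sub>1 * x11 + \<kappa>\<^sub>0 * x01))"
      unfolding V by (simp add: field_simps)
    have b: "q \<le> 2 * V" "y00 \<le> 2 * V" "\<delta>\<^sup>2 * x00 \<le> V" "y01 \<le> 2 * V" "\<delta>\<^sup>2 * x01 \<le> 2 * V"
      "\<kappa>\<^sub>1 * x11 + \<kappa>\<^sub>0 * x01 \<le> 2 * V"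
      using V2 low \<delta>x h(2,4) y01 by simp_all
    have V0: "0 \<le> V" using b(2) h(2) by linarith
    have x00': "x00 \<le> V / \<delta>\<^sup>2" and x01': "x01 \<le> 2 * V / \<delta>\<^sup>2"
      using b(3,5) assms(4) by (simp_all add: field_simps)
    \<comment> \<open>For \<open>\<beta> = 0\<close> the term with
      \<open>\<kappa>\<^sub>1 = 1\<close> controls \<open>x11\<close>. For
      \<open>\<beta> > 0\<close> the coefficient \<open>\<kappa>\<^sub>1\<close> may vanish, and the
      control comes from the square \<open>q\<close>.\<close>
    have "x11 \<le> (if \<beta> = 0 then 2 + 2 * \<bar>\<kappa>\<^sub>0\<bar> / \<delta>\<^sup>2 else 3 * (4 + a\<^sup>2 / \<delta>\<^sup>2) / \<beta>\<^sup>2) * V"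
    proof (cases "\<beta> = 0")
      case True
      then have "\<kappa>\<^sub>1 = 1" by (simp add: \<kappa>\<^sub>1_def)
      have "- (\<kappa>\<^sub>0 * x01) \<le> \<bar>\<kappa>\<^sub>0\<bar> * x01" using x01 abs_ge_minus_self mult_right_mono by fastforce
      also have "\<dots> \<le> \<bar>\<kappa>\<^sub>0\<bar> * (2 * V / \<delta>\<^sup>2)" using x01' by (intro mult_left_mono) auto
      finally show ?thesis using b(6) True \<open>\<kappa>\<^sub>1 = 1\<close> by (simp add: algebra_simps)
    next
      case False
      have "a\<^sup>2 * x00 \<le> a\<^sup>2 * (V / \<delta>\<^sup>2)" using x00' by (intro mult_left_mono) auto
      then have "\<beta>\<^sup>2 * x11 \<le> 3 * (4 * V + a\<^sup>2 * (V / \<delta>\<^sup>2))"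
        using q1 b(1,2) by simp
      also have "\<dots> = 3 * (4 + a\<^sup>2 / \<delta>\<^sup>2) * V"
        by (simp add: distrib_right)
      finally have "\<beta>\<^sup>2 * x11 \<le> 3 * (4 + a\<^sup>2 / \<delta>\<^sup>2) * V" .
      moreover have "\<beta>\<^sup>2 > 0" using False by simp
      ultimately show ?thesis using False by (simp add: field_simps)
    qed
    moreover have "z \<le> 8 * V" using z(1) b(4,5) by simp
    ultimately have "z + x11 \<le> D * V" unfolding D_def by (simp add: algebra_simps)
    with upper show ?thesis unfolding V_def by blast
  qed
  note key = this[unfolded a_def]
  show ?thesis
  proof (rule exI[of _ C], rule conjI[OF \<open>C > 0\<close>], rule exI[of _ D], rule conjI[OF \<open>D > 0\<close>], intro allI impI)
    fix x00 x01 x11 y00 y01 w00 w10 q z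
    show "lyapunov \<alpha> \<beta> \<delta> x00 x01 x11 y00 y01 w00 w10 \<le> C * (z + x11) \<and>
        z + x11 \<le> D * lyapunov \<alpha> \<beta> \<delta> x00 x01 x11 y00 y01 w00 w10"
      if "0 \<le> x00" "0 \<le> y00" "0 \<le> z" "0 \<le> q" "l * x00 \<le> x01" "l * x01 \<le> x11" "l * y00 \<le> y01"
        "q = \<beta>\<^sup>2 * x11 + 2 * \<beta> * (\<alpha> - 2 * \<delta>) * x01 + (\<alpha> - 2 * \<delta>)\<^sup>2 * x00 + 2 * \<beta> * w10
          + 2 * (\<alpha> - 2 * \<delta>) * w00 + y00"
        "\<beta>\<^sup>2 * x11 \<le> 3 * (q + (\<alpha> - 2 * \<delta>)\<^sup>2 * x00 + y00)"
        "q \<le> 3 * (\<beta>\<^sup>2 * x11 + (\<alpha> - 2 * \<delta>)\<^sup>2 * x00 + y00)"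
        "z \<le> 2 * y01 + 2 * \<delta>\<^sup>2 * x01" "y01 \<le> 2 * z + 2 * \<delta>\<^sup>2 * x01"
      by (rule key[OF that])
  qed
qed

section \<open>Linear algebra in coordinates\<close>

lemma dot_on_add_left: "dot_on E (\<lambda>e. x e + y e) z = dot_on E x z + dot_on E y z"
  by (simp add: dot_on_def distrib_right sum.distrib)

lemma dot_on_diff_left: "dot_on E (\<lambda>e. x e - y e) z = dot_on E x z - dot_on E y z"
  by (simp add: dot_on_def left_diff_distrib sum_subtractf)

lemma dot_on_scale_left: "dot_on E (\<lambda>e. r * x e) z = r * dot_on E x z"
  by (simp add: dot_on_def sum_distrib_left mult.assoc)

lemma dot_on_add_right: "dot_on E z (\<lambda>e. x e + y e) = dot_on E z x + dot_on E z y"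
  by (simp add: dot_on_def distrib_left sum.distrib)

lemma dot_on_diff_right: "dot_on E z (\<lambda>e. x e - y e) = dot_on E z x - dot_on E z y"
  by (simp add: dot_on_def right_diff_distrib sum_subtractf)

lemma dot_on_scale_right: "dot_on E z (\<lambda>e. r * x e) = r * dot_on E z x"
  by (simp add: dot_on_def sum_distrib_left mult_ac)

lemma dot_on_minus_left: "dot_on E (\<lambda>e. - x e) z = - dot_on E x z"
  by (simp add: dot_on_def sum_negf)

lemma dot_on_minus_right: "dot_on E z (\<lambda>e. - x e) = - dot_on E z x"
  by (simp add: dot_on_def sum_negf)

lemmas dot_on_linear = dot_on_minus_left dot_on_minus_right dot_on_add_left dot_on_diff_left dot_on_scale_left
  dot_on_add_right dot_on_diff_right dot_on_scale_right

lemma mat_app_add: "mat_app E M (\<lambda>e. x e + y e) = (\<lambda>e. mat_app E M x e + mat_app E M y e)"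
  by (simp add: mat_app_def fun_eq_iff distrib_left sum.distrib)

lemma mat_app_scale: "mat_app E M (\<lambda>e. r * x e) = (\<lambda>e. r * mat_app E M x e)"
  by (simp add: mat_app_def fun_eq_iff sum_distrib_left mult_ac)

definition lyapunov_at :: "real \<Rightarrow> real \<Rightarrow> real \<Rightarrow> 'i set \<Rightarrow> ('i \<Rightarrow> 'i \<Rightarrow> real) \<Rightarrow>
    ('i \<Rightarrow> real) \<Rightarrow> ('i \<Rightarrow> real) \<Rightarrow> real" where
  "lyapunov_at \<alpha> \<beta> \<delta> E M x y =
     (let p = (\<lambda>e. y e + \<delta> * x e); T = mat_app E M in
      lyapunov \<alpha> \<beta> \<delta> (dot_on E x x) (dot_on E x (T x)) (dot_on E (T x) (T x))
        (dot_on E p p) (dot_on E p (T p)) (dot_on E x p) (dot_on E (T x) p))"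

text \<open>Twice the discrete energy: the factor 1/2 is dropped.\<close>

definition energy_at :: "'i set \<Rightarrow> ('i \<Rightarrow> 'i \<Rightarrow> real) \<Rightarrow> ('i \<Rightarrow> real) \<Rightarrow> ('i \<Rightarrow> real) \<Rightarrow> real" where
  "energy_at E M x y = dot_on E y (mat_app E M y) + dot_on E (mat_app E M x) (mat_app E M x)"

definition symmetric_coercive :: "real \<Rightarrow> 'i set \<Rightarrow> ('i \<Rightarrow> 'i \<Rightarrow> real) \<Rightarrow> bool" where
  "symmetric_coercive l E M \<longleftrightarrow> (\<forall>e\<in>E. \<forall>f\<in>E. M e f = M f e) \<and>
     (\<forall>x. l * dot_on E x x \<le> dot_on E x (mat_app E M x))"

text \<open>Expanding the square of \<open>(M - l) x\<close> and adding \<open>l\<close> times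
  coercivity yields the order relation between \<open>M^2\<close> and \<open>l * M\<close> without
  diagonalising \<open>M\<close>.\<close>

lemma symmetric_coercive_square:
  assumes "symmetric_coercive l E M" "l > 0"
  shows "0 \<le> dot_on E (mat_app E M x) (mat_app E M x) - 2 * l * dot_on E x (mat_app E M x) + l\<^sup>2 * dot_on E x x"
    and "l * dot_on E x (mat_app E M x) \<le> dot_on E (mat_app E M x) (mat_app E M x)"
proof -
  let ?T = "mat_app E M"
  have "0 \<le> dot_on E (\<lambda>e. ?T x e - l * x e) (\<lambda>e. ?T x e - l * x e)"
    by (rule dot_on_nonneg)
  then show *: "0 \<le> dot_on E (?T x) (?T x) - 2 * l * dot_on E x (?T x) + l\<^sup>2 * dot_on E x x"
    by (simp add: dot_on_linear dot_on_commute[of E "?T x" x] power2_eq_square algebra_simps)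
  have "l * (l * dot_on E x x) \<le> l * dot_on E x (?T x)"
    using assms by (intro mult_left_mono) (auto simp: symmetric_coercive_def)
  with * show "l * dot_on E x (?T x) \<le> dot_on E (?T x) (?T x)"
    by (simp add: power2_eq_square algebra_simps)
qed

lemma symmetric_coercive_nonneg:
  assumes "symmetric_coercive l E M" "l > 0"
  shows "0 \<le> dot_on E x (mat_app E M x)"
proof -
  have "0 \<le> l * dot_on E x x" using assms(2) dot_on_nonneg[of E x] by simp
  also have "\<dots> \<le> dot_on E x (mat_app E M x)" using assms(1) by (auto simp: symmetric_coercive_def)
  finally show ?thesis .
qed

text \<open>Reduction to the scalar lemma, with moments of \<open>M\<close> in place of powers of
  \<open>\<mu>\<close> and \<open>q\<close> the squared norm of \<open>B x + p\<close>. The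
  constants are fixed before \<open>E\<close> and \<open>M\<close>, hence are independent of the
  dimension.\<close>

lemma lyapunov_at_equiv_energy_at:
  fixes \<alpha> \<beta> \<delta> l :: real
  assumes "\<alpha> \<ge> 0" "\<beta> \<ge> 0" "l > 0" "\<delta> > 0" "2 * \<delta> \<le> \<alpha> + \<beta> * l" "\<delta> * (\<alpha> + \<beta> * l) \<le> l"
  shows "\<exists>C>0. \<exists>D>0. \<forall>(E :: 'i set) M x y. symmetric_coercive l E M \<longrightarrow>
    lyapunov_at \<alpha> \<beta> \<delta> E M x y \<le> C * energy_at E M x y \<and>
    energy_at E M x y \<le> D * lyapunov_at \<alpha> \<beta> \<delta> E M x y"
proof -
  obtain C D where CD: "C > 0" "D > 0" and equiv: "\<And>x00 x01 x11 y00 y01 w00 w10 q z.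
    0 \<le> x00 \<Longrightarrow> 0 \<le> y00 \<Longrightarrow> 0 \<le> z \<Longrightarrow> 0 \<le> q \<Longrightarrow> l * x00 \<le> x01 \<Longrightarrow> l * x01 \<le> x11 \<Longrightarrow> l * y00 \<le> y01 \<Longrightarrow>
    q = \<beta>\<^sup>2 * x11 + 2 * \<beta> * (\<alpha> - 2 * \<delta>) * x01 + (\<alpha> - 2 * \<delta>)\<^sup>2 * x00 + 2 * \<beta> * w10
      + 2 * (\<alpha> - 2 * \<delta>) * w00 + y00 \<Longrightarrow>
    \<beta>\<^sup>2 * x11 \<le> 3 * (q + (\<alpha> - 2 * \<delta>)\<^sup>2 * x00 + y00) \<Longrightarrow>
    q \<le> 3 * (\<beta>\<^sup>2 * x11 + (\<alpha> - 2 * \<delta>)\<^sup>2 * x00 + y00) \<Longrightarrow>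
    z \<le> 2 * y01 + 2 * \<delta>\<^sup>2 * x01 \<Longrightarrow> y01 \<le> 2 * z + 2 * \<delta>\<^sup>2 * x01 \<Longrightarrow>
    lyapunov \<alpha> \<beta> \<delta> x00 x01 x11 y00 y01 w00 w10 \<le> C * (z + x11) \<and>
    z + x11 \<le> D * lyapunov \<alpha> \<beta> \<delta> x00 x01 x11 y00 y01 w00 w10"
    using lyapunov_equiv_energy[OF assms] by metis
  have "lyapunov_at \<alpha> \<beta> \<delta> E M x y \<le> C * energy_at E M x y \<and>
      energy_at E M x y \<le> D * lyapunov_at \<alpha> \<beta> \<delta> E M x y"
    if M: "symmetric_coercive l E M" for E :: "'i set" and M x y
  proof -
    define T where "T = mat_app E M"
    define p where "p = (\<lambda>e. y e + \<delta> * x e)"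
    define a where "a = \<alpha> - 2 * \<delta>"
    have sym: "dot_on E v (T w) = dot_on E (T v) w" for v w
      unfolding T_def by (rule dot_on_mat_app) (use M in \<open>auto simp: symmetric_coercive_def\<close>)
    note pos = symmetric_coercive_nonneg[OF M \<open>l > 0\<close>, folded T_def]
    have coer: "l * dot_on E v v \<le> dot_on E v (T v)" for v
      using M by (simp add: symmetric_coercive_def T_def)
    have Tp: "T p = (\<lambda>e. T y e + \<delta> * T x e)"
      by (simp add: T_def p_def mat_app_add mat_app_scale)
    have xTy: "dot_on E x (T y) = dot_on E y (T x)"
      using sym[of x y] by (simp add: dot_on_commute)
    let ?r = "\<lambda>e. \<beta> * T x e + a * x e + p e"
    have q: "dot_on E ?r ?r = \<beta>\<^sup>2 * dot_on E (T x) (T x) + 2 * \<beta> * a * dot_on E x (T x)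
        + a\<^sup>2 * dot_on E x x + 2 * \<beta> * dot_on E (T x) p + 2 * a * dot_on E x p + dot_on E p p"
      by (simp add: dot_on_linear dot_on_commute[of E p "T x"] dot_on_commute[of E p x]
          dot_on_commute[of E "T x" x] power2_eq_square algebra_simps)
    have three: "(r + s + t)\<^sup>2 \<le> 3 * (r\<^sup>2 + s\<^sup>2 + t\<^sup>2)" for r s t :: real
    proof -
      have "0 \<le> (r - s)\<^sup>2 + (s - t)\<^sup>2 + (r - t)\<^sup>2" by simp
      then show ?thesis by (simp add: power2_eq_square algebra_simps)
    qed
    have sum3: "dot_on E u u \<le> 3 * (dot_on E v v + dot_on E w w + dot_on E z z)"
      if "\<And>e. (u e)\<^sup>2 \<le> 3 * ((v e)\<^sup>2 + (w e)\<^sup>2 + (z e)\<^sup>2)" for u v w z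
      using sum_mono[of E "\<lambda>e. (u e)\<^sup>2" "\<lambda>e. 3 * ((v e)\<^sup>2 + (w e)\<^sup>2 + (z e)\<^sup>2)"] that
      by (simp add: dot_on_def power2_eq_square sum.distrib sum_distrib_left[symmetric])
    have "dot_on E (\<lambda>e. \<beta> * T x e) (\<lambda>e. \<beta> * T x e)
        \<le> 3 * (dot_on E ?r ?r + dot_on E (\<lambda>e. a * x e) (\<lambda>e. a * x e) + dot_on E p p)"
    proof (rule sum3)
      \<comment> \<open>Here \<open>\<beta> * T x\<close> is written as
        \<open>?r - a * x - p\<close>.\<close>
      show "(\<beta> * T x e)\<^sup>2 \<le> 3 * ((?r e)\<^sup>2 + (a * x e)\<^sup>2 + (p e)\<^sup>2)" for e
        using three[of "?r e" "- (a * x e)" "- p e"] by simp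
    qed
    then have q1: "\<beta>\<^sup>2 * dot_on E (T x) (T x) \<le> 3 * (dot_on E ?r ?r + a\<^sup>2 * dot_on E x x + dot_on E p p)"
      by (simp only: dot_on_scale_left dot_on_scale_right power2_eq_square mult.assoc)
    have "dot_on E ?r ?r \<le> 3 * (dot_on E (\<lambda>e. \<beta> * T x e) (\<lambda>e. \<beta> * T x e)
        + dot_on E (\<lambda>e. a * x e) (\<lambda>e. a * x e) + dot_on E p p)"
      by (rule sum3) (rule three)
    then have q2: "dot_on E ?r ?r \<le> 3 * (\<beta>\<^sup>2 * dot_on E (T x) (T x) + a\<^sup>2 * dot_on E x x + dot_on E p p)"
      by (simp only: dot_on_scale_left dot_on_scale_right power2_eq_square mult.assoc)
    have z1: "dot_on E y (T y) \<le> 2 * dot_on E p (T p) + 2 * \<delta>\<^sup>2 * dot_on E x (T x)"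
    proof -
      \<comment> \<open>The right side minus the left side is the quadratic form of \<open>M\<close>
        at \<open>y + 2 * \<delta> * x\<close>.\<close>
      let ?v = "\<lambda>e. y e + (2 * \<delta>) * x e"
      have "T ?v = (\<lambda>e. T y e + (2 * \<delta>) * T x e)" by (simp add: T_def mat_app_add mat_app_scale)
      then have "0 \<le> dot_on E ?v (\<lambda>e. T y e + (2 * \<delta>) * T x e)" using pos[of ?v] by simp
      then show ?thesis
        unfolding Tp unfolding p_def
        by (simp only: dot_on_linear xTy) (simp add: power2_eq_square algebra_simps)
    qed
    have z2: "dot_on E p (T p) \<le> 2 * dot_on E y (T y) + 2 * \<delta>\<^sup>2 * dot_on E x (T x)"
    proof -
      \<comment> \<open>Now the difference of the two sides is the form at
        \<open>y - \<delta> * x\<close>.\<close>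
      let ?v = "\<lambda>e. y e - \<delta> * x e"
      have "T ?v = (\<lambda>e. T y e - \<delta> * T x e)"
        using mat_app_add[of E M y "\<lambda>e. (- \<delta>) * x e"] mat_app_scale[of E M "- \<delta>" x] by (simp add: T_def)
      then have "0 \<le> dot_on E ?v (\<lambda>e. T y e - \<delta> * T x e)" using pos[of ?v] by simp
      then show ?thesis
        unfolding Tp unfolding p_def
        by (simp only: dot_on_linear xTy) (simp add: power2_eq_square algebra_simps)
    qed
    have "lyapunov \<alpha> \<beta> \<delta> (dot_on E x x) (dot_on E x (T x)) (dot_on E (T x) (T x))
        (dot_on E p p) (dot_on E p (T p)) (dot_on E x p) (dot_on E (T x) p)
        \<le> C * (dot_on E y (T y) + dot_on E (T x) (T x)) \<and>
      dot_on E y (T y) + dot_on E (T x) (T x) \<le> D * lyapunov \<alpha> \<beta> \<delta> (dot_on E x x) (dot_on E x (T x))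
        (dot_on E (T x) (T x)) (dot_on E p p) (dot_on E p (T p)) (dot_on E x p) (dot_on E (T x) p)"
      by (rule equiv[OF dot_on_nonneg dot_on_nonneg pos dot_on_nonneg coer
            symmetric_coercive_square(2)[OF M \<open>l > 0\<close>, folded T_def] coer
            q[unfolded a_def] q1[unfolded a_def] q2[unfolded a_def] z1 z2])
    then show ?thesis
      by (simp add: lyapunov_at_def energy_at_def Let_def T_def p_def)
  qed
  with CD show ?thesis by blast
qed

section \<open>Exponential decay of the Lyapunov functional\<close>

text \<open>Symmetry of \<open>M\<close> reduces \<open>V'\<close> to moments of \<open>c\<close>
  and \<open>p\<close>, which combine to \<open>- 2 * \<delta> * V - D\<close> with
  \<open>D \<ge> 0\<close>; the integrating factor \<open>exp (2 * \<delta> * s)\<close> then gives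
  the bound.\<close>

lemma lyapunov_at_decay:
  fixes \<alpha> \<beta> \<delta> l :: real and c d :: "real \<Rightarrow> 'i \<Rightarrow> real"
  assumes "\<alpha> \<ge> 0" "\<beta> \<ge> 0" "l > 0" "\<delta> > 0" "2 * \<delta> \<le> \<alpha> + \<beta> * l" "\<delta> * (\<alpha> + \<beta> * l) \<le> l"
    and M: "symmetric_coercive l E M"
    and c: "\<And>t e. t \<ge> 0 \<Longrightarrow> e \<in> E \<Longrightarrow> ((\<lambda>s. c s e) has_real_derivative d t e) (at t within {0..})"
    and d: "\<And>t e. t \<ge> 0 \<Longrightarrow> e \<in> E \<Longrightarrow> ((\<lambda>s. d s e) has_real_derivative
        - (\<beta> * mat_app E M (d t) e + \<alpha> * d t e + mat_app E M (c t) e)) (at t within {0..})"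
    and t: "t \<ge> 0"
  shows "lyapunov_at \<alpha> \<beta> \<delta> E M (c t) (d t) \<le> exp (- 2 * \<delta> * t) * lyapunov_at \<alpha> \<beta> \<delta> E M (c 0) (d 0)"
proof -
  define T where "T = mat_app E M"
  define a \<kappa>\<^sub>1 \<kappa>\<^sub>0 where "a = \<alpha> - 2 * \<delta>" and "\<kappa>\<^sub>1 = 1 - \<delta> * \<beta>" and "\<kappa>\<^sub>0 = \<delta>\<^sup>2 - \<delta> * \<alpha>"
  define p where "p = (\<lambda>t e. d t e + \<delta> * c t e)"
  define V where "V = (\<lambda>t. lyapunov_at \<alpha> \<beta> \<delta> E M (c t) (d t))"
  have sym: "dot_on E v (T w) = dot_on E (T v) w" for v w
    unfolding T_def by (rule dot_on_mat_app) (use M in \<open>auto simp: symmetric_coercive_def\<close>)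
  have coer: "l * dot_on E v v \<le> dot_on E v (T v)" for v
    using M by (simp add: symmetric_coercive_def T_def)
  have \<kappa>\<^sub>1: "\<kappa>\<^sub>1 \<ge> 0"
  proof -
    have "\<delta> * \<alpha> \<ge> 0" using assms by simp
    then have "(\<delta> * \<beta>) * l \<le> 1 * l" using assms(6) by (simp add: algebra_simps)
    then have "\<delta> * \<beta> \<le> 1" using \<open>l > 0\<close> mult_le_cancel_right_pos by blast
    then show ?thesis by (simp add: \<kappa>\<^sub>1_def)
  qed
  have k_min: "0 \<le> \<kappa>\<^sub>1 * l + \<kappa>\<^sub>0"
  proof -
    have "\<kappa>\<^sub>1 * l + \<kappa>\<^sub>0 = (l - \<delta> * (\<alpha> + \<beta> * l)) + \<delta>\<^sup>2"
      by (simp add: \<kappa>\<^sub>1_def \<kappa>\<^sub>0_def algebra_simps)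
    then show ?thesis using assms(6) by simp
  qed
  have B_min: "0 \<le> \<beta> * l + a" using assms(5) by (simp add: a_def)
  have "\<exists>D. (V has_real_derivative - 2 * \<delta> * V s - D) (at s within {0..}) \<and> D \<ge> 0" if s: "s \<ge> 0" for s
  proof -
    \<comment> \<open>The equation for \<open>p\<close> after eliminating
      \<open>d = p - \<delta> * c\<close>.\<close>
    define p' where "p' = (\<lambda>e. - \<delta> * p s e - \<beta> * T (p s) e - a * p s e - \<kappa>\<^sub>1 * T (c s) e - \<kappa>\<^sub>0 * c s e)"
    define c' where "c' = (\<lambda>e. p s e - \<delta> * c s e)"
    have Tp: "T (p s) = (\<lambda>e. T (d s) e + \<delta> * T (c s) e)"
      by (simp add: T_def p_def mat_app_add mat_app_scale)
    have c_der: "((\<lambda>s. c s e) has_real_derivative c' e) (at s within {0..})" if "e \<in> E" for e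
      using c[OF s that] by (simp add: c'_def p_def)
    have p_der: "((\<lambda>s. p s e) has_real_derivative p' e) (at s within {0..})" if "e \<in> E" for e
    proof -
      have "((\<lambda>s. p s e) has_real_derivative
          - (\<beta> * T (d s) e + \<alpha> * d s e + T (c s) e) + \<delta> * d s e) (at s within {0..})"
        unfolding p_def T_def by (intro DERIV_add DERIV_cmult c d s that)
      moreover have "- (\<beta> * T (d s) e + \<alpha> * d s e + T (c s) e) + \<delta> * d s e = p' e"
        unfolding p'_def Tp unfolding p_def a_def \<kappa>\<^sub>1_def \<kappa>\<^sub>0_def
        by (simp add: power2_eq_square algebra_simps)
      ultimately show ?thesis by simp
    qed
    have Tc_der: "((\<lambda>s. T (c s) e) has_real_derivative T c' e) (at s within {0..})"
      and Tp_der: "((\<lambda>s. T (p s) e) has_real_derivative T p' e) (at s within {0..})" for e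
      unfolding T_def by (rule mat_app_has_derivative, erule c_der p_der)+
    \<comment> \<open>\<open>x\<close>, \<open>y\<close>, \<open>w\<close> pair \<open>c\<close>
      with \<open>c\<close>, \<open>p\<close> with \<open>p\<close> and \<open>c\<close> with
      \<open>p\<close>; the digits count applications of \<open>T\<close> to the left and right
      factor. In \<open>V'\<close> the terms with \<open>w11\<close> cancel.\<close>
    define x00 x01 x11 y00 y01 y11 w00 w10 w11 where
      "x00 = dot_on E (c s) (c s)" and "x01 = dot_on E (c s) (T (c s))"
      and "x11 = dot_on E (T (c s)) (T (c s))" and "y00 = dot_on E (p s) (p s)"
      and "y01 = dot_on E (p s) (T (p s))" and "y11 = dot_on E (T (p s)) (T (p s))"
      and "w00 = dot_on E (c s) (p s)" and "w10 = dot_on E (T (c s)) (p s)"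
      and "w11 = dot_on E (T (c s)) (T (p s))"
    have comm: "dot_on E (p s) (c s) = w00" "dot_on E (p s) (T (c s)) = w10" "dot_on E (c s) (T (p s)) = w10"
      "dot_on E (T (p s)) (c s) = w10" "dot_on E (T (p s)) (T (c s)) = w11" "dot_on E (T (p s)) (p s) = y01"
      "dot_on E (T (c s)) (c s) = x01"
      using sym[of "c s" "p s"] dot_on_commute[of E]
      by (simp_all add: w00_def w10_def w11_def y01_def x01_def)
    note names = comm x00_def[symmetric] x01_def[symmetric] x11_def[symmetric] y00_def[symmetric]
      y01_def[symmetric] y11_def[symmetric] w00_def[symmetric] w10_def[symmetric] w11_def[symmetric]
    have T_c': "T c' = (\<lambda>e. T (p s) e - \<delta> * T (c s) e)"
      using mat_app_add[of E M "p s" "\<lambda>e. (- \<delta>) * c s e"] mat_app_scale[of E M "- \<delta>" "c s"]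
      by (simp add: T_def c'_def)
    have x00': "((\<lambda>s. dot_on E (c s) (c s)) has_real_derivative 2 * (w00 - \<delta> * x00)) (at s within {0..})"
      by (rule DERIV_cong[OF dot_on_has_derivative[OF c_der c_der]])
        (simp_all add: c'_def dot_on_linear names)
    have x01': "((\<lambda>s. dot_on E (c s) (T (c s))) has_real_derivative 2 * (w10 - \<delta> * x01)) (at s within {0..})"
      by (rule DERIV_cong[OF dot_on_has_derivative[OF c_der Tc_der]])
        (simp_all add: T_c', simp_all add: c'_def dot_on_linear names)
    have x11': "((\<lambda>s. dot_on E (T (c s)) (T (c s))) has_real_derivative 2 * (w11 - \<delta> * x11)) (at s within {0..})"
      by (rule DERIV_cong[OF dot_on_has_derivative[OF Tc_der Tc_der]])
        (simp_all add: T_c' dot_on_linear names)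
    have y00': "((\<lambda>s. dot_on E (p s) (p s)) has_real_derivative
        2 * (- \<delta> * y00 - \<beta> * y01 - a * y00 - \<kappa>\<^sub>1 * w10 - \<kappa>\<^sub>0 * w00)) (at s within {0..})"
      by (rule DERIV_cong[OF dot_on_has_derivative[OF p_der p_der]])
        (simp_all add: p'_def dot_on_linear names)
    have p'_Tp: "dot_on E p' (T (p s)) = - \<delta> * y01 - \<beta> * y11 - a * y01 - \<kappa>\<^sub>1 * w11 - \<kappa>\<^sub>0 * w10"
      by (simp add: p'_def dot_on_linear names)
    have y01': "((\<lambda>s. dot_on E (p s) (T (p s))) has_real_derivative
        2 * (- \<delta> * y01 - \<beta> * y11 - a * y01 - \<kappa>\<^sub>1 * w11 - \<kappa>\<^sub>0 * w10)) (at s within {0..})"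
    proof (rule DERIV_cong[OF dot_on_has_derivative[OF p_der Tp_der]])
      have "dot_on E (p s) (T p') = dot_on E p' (T (p s))"
        using sym[of "p s" p'] by (simp add: dot_on_commute)
      then show "dot_on E p' (T (p s)) + dot_on E (p s) (T p') =
          2 * (- \<delta> * y01 - \<beta> * y11 - a * y01 - \<kappa>\<^sub>1 * w11 - \<kappa>\<^sub>0 * w10)"
        using p'_Tp by simp
    qed
    have w00': "((\<lambda>s. dot_on E (c s) (p s)) has_real_derivative
        y00 - 2 * \<delta> * w00 - \<beta> * w10 - a * w00 - \<kappa>\<^sub>1 * x01 - \<kappa>\<^sub>0 * x00) (at s within {0..})"
      by (rule DERIV_cong[OF dot_on_has_derivative[OF c_der p_der]])
        (simp_all add: c'_def p'_def dot_on_linear names)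
    have w10': "((\<lambda>s. dot_on E (T (c s)) (p s)) has_real_derivative
        y01 - 2 * \<delta> * w10 - \<beta> * w11 - a * w10 - \<kappa>\<^sub>1 * x11 - \<kappa>\<^sub>0 * x01) (at s within {0..})"
      by (rule DERIV_cong[OF dot_on_has_derivative[OF Tc_der p_der]])
        (simp_all add: T_c' p'_def dot_on_linear names)
    have V_eq: "V = (\<lambda>s. (\<beta>\<^sup>2 * dot_on E (T (c s)) (T (c s)) + 2 * \<beta> * a * dot_on E (c s) (T (c s))
        + a\<^sup>2 * dot_on E (c s) (c s)) / 2 + \<beta> * dot_on E (T (c s)) (p s) + a * dot_on E (c s) (p s)
        + dot_on E (p s) (p s) + \<kappa>\<^sub>1 * dot_on E (c s) (T (c s)) + \<kappa>\<^sub>0 * dot_on E (c s) (c s)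
        + (dot_on E (p s) (T (p s)) + \<kappa>\<^sub>1 * dot_on E (T (c s)) (T (c s)) + \<kappa>\<^sub>0 * dot_on E (c s) (T (c s))) / 2)"
      unfolding V_def lyapunov_at_def lyapunov_def Let_def T_def p_def a_def \<kappa>\<^sub>1_def \<kappa>\<^sub>0_def by simp
    \<comment> \<open>The three groups are \<open>(B p, p)\<close>, \<open>(B k c, c)\<close> and
      \<open>(M B p, p)\<close>.\<close>
    define D where "D = (\<beta> * y01 + a * y00)
        + (\<beta> * \<kappa>\<^sub>1 * x11 + (\<beta> * \<kappa>\<^sub>0 + a * \<kappa>\<^sub>1) * x01 + a * \<kappa>\<^sub>0 * x00) + (\<beta> * y11 + a * y01)"
    have "(V has_real_derivative - 2 * \<delta> * V s - D) (at s within {0..})"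
    proof (rule DERIV_cong)
      show "(V has_real_derivative (\<beta>\<^sup>2 * (2 * (w11 - \<delta> * x11)) + 2 * \<beta> * a * (2 * (w10 - \<delta> * x01))
          + a\<^sup>2 * (2 * (w00 - \<delta> * x00))) / 2
        + \<beta> * (y01 - 2 * \<delta> * w10 - \<beta> * w11 - a * w10 - \<kappa>\<^sub>1 * x11 - \<kappa>\<^sub>0 * x01)
        + a * (y00 - 2 * \<delta> * w00 - \<beta> * w10 - a * w00 - \<kappa>\<^sub>1 * x01 - \<kappa>\<^sub>0 * x00)
        + 2 * (- \<delta> * y00 - \<beta> * y01 - a * y00 - \<kappa>\<^sub>1 * w10 - \<kappa>\<^sub>0 * w00)
        + \<kappa>\<^sub>1 * (2 * (w10 - \<delta> * x01)) + \<kappa>\<^sub>0 * (2 * (w00 - \<delta> * x00))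
        + (2 * (- \<delta> * y01 - \<beta> * y11 - a * y01 - \<kappa>\<^sub>1 * w11 - \<kappa>\<^sub>0 * w10)
          + \<kappa>\<^sub>1 * (2 * (w11 - \<delta> * x11)) + \<kappa>\<^sub>0 * (2 * (w10 - \<delta> * x01))) / 2) (at s within {0..})"
        unfolding V_eq
        by (intro DERIV_add DERIV_cmult DERIV_cdivide x00' x01' x11' y00' y01' w00' w10')
    next
      show "(\<beta>\<^sup>2 * (2 * (w11 - \<delta> * x11)) + 2 * \<beta> * a * (2 * (w10 - \<delta> * x01))
          + a\<^sup>2 * (2 * (w00 - \<delta> * x00))) / 2
        + \<beta> * (y01 - 2 * \<delta> * w10 - \<beta> * w11 - a * w10 - \<kappa>\<^sub>1 * x11 - \<kappa>\<^sub>0 * x01)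
        + a * (y00 - 2 * \<delta> * w00 - \<beta> * w10 - a * w00 - \<kappa>\<^sub>1 * x01 - \<kappa>\<^sub>0 * x00)
        + 2 * (- \<delta> * y00 - \<beta> * y01 - a * y00 - \<kappa>\<^sub>1 * w10 - \<kappa>\<^sub>0 * w00)
        + \<kappa>\<^sub>1 * (2 * (w10 - \<delta> * x01)) + \<kappa>\<^sub>0 * (2 * (w00 - \<delta> * x00))
        + (2 * (- \<delta> * y01 - \<beta> * y11 - a * y01 - \<kappa>\<^sub>1 * w11 - \<kappa>\<^sub>0 * w10)
          + \<kappa>\<^sub>1 * (2 * (w11 - \<delta> * x11)) + \<kappa>\<^sub>0 * (2 * (w10 - \<delta> * x01))) / 2 = - 2 * \<delta> * V s - D"
        unfolding V_eq D_def names by (simp add: power2_eq_square field_simps)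
    qed
    moreover have "D \<ge> 0"
    proof -
      \<comment> \<open>Both \<open>a\<close> and \<open>\<kappa>\<^sub>0\<close> may be negative.
        Expanding in powers of \<open>M - l\<close> leaves the nonnegative coefficients
        \<open>\<beta>\<close>, \<open>\<kappa>\<^sub>1\<close>, \<open>\<beta> * l + a\<close> and
        \<open>\<kappa>\<^sub>1 * l + \<kappa>\<^sub>0\<close>.\<close>
      have D1: "0 \<le> \<beta> * (y01 - l * y00) + (\<beta> * l + a) * y00"
        using coer[of "p s"] B_min assms(2) dot_on_nonneg[of E "p s"] by (simp add: y01_def y00_def)
      have D2: "0 \<le> \<beta> * \<kappa>\<^sub>1 * (x11 - 2 * l * x01 + l\<^sup>2 * x00)
          + (\<beta> * (\<kappa>\<^sub>1 * l + \<kappa>\<^sub>0) + (\<beta> * l + a) * \<kappa>\<^sub>1) * (x01 - l * x00) + (\<beta> * l + a) * (\<kappa>\<^sub>1 * l + \<kappa>\<^sub>0) * x00"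
      proof -
        \<comment> \<open>\<open>X0\<close>, \<open>X1\<close>, \<open>X2\<close> are the moments of
          \<open>c\<close> with powers 0, 1, 2 of \<open>M - l\<close>; \<open>L\<close> and
          \<open>K\<close> are the values of \<open>B\<close> and \<open>k\<close> at
          \<open>l\<close>.\<close>
        define X0 X1 X2 L K where "X0 = x00" and "X1 = x01 - l * x00" and "X2 = x11 - 2 * l * x01 + l\<^sup>2 * x00"
          and "L = \<beta> * l + a" and "K = \<kappa>\<^sub>1 * l + \<kappa>\<^sub>0"
        have "X0 \<ge> 0" "X1 \<ge> 0" "X2 \<ge> 0" "L \<ge> 0" "K \<ge> 0"
          using coer[of "c s"] B_min k_min dot_on_nonneg[of E "c s"]
            symmetric_coercive_square(1)[OF M \<open>l > 0\<close>, of "c s", folded T_def]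
          by (simp_all add: X0_def X1_def X2_def L_def K_def x00_def x01_def x11_def)
        then have "0 \<le> \<beta> * \<kappa>\<^sub>1 * X2 + (\<beta> * K + L * \<kappa>\<^sub>1) * X1 + L * K * X0"
          using \<kappa>\<^sub>1 assms(2) by simp
        then show ?thesis unfolding X0_def X1_def X2_def L_def K_def .
      qed
      have D3: "0 \<le> \<beta> * (y11 - l * y01) + (\<beta> * l + a) * y01"
        using B_min assms(2) symmetric_coercive_square(2)[OF M \<open>l > 0\<close>, of "p s", folded T_def]
          symmetric_coercive_nonneg[OF M \<open>l > 0\<close>, of "p s", folded T_def]
        by (simp add: y01_def y11_def)
      show ?thesis
        using add_nonneg_nonneg[OF add_nonneg_nonneg[OF D1 D2] D3]
        unfolding D_def by (simp add: power2_eq_square algebra_simps)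
    qed
    ultimately show ?thesis by blast
  qed
  then obtain D where D: "\<And>s. s \<ge> 0 \<Longrightarrow> (V has_real_derivative - 2 * \<delta> * V s - D s) (at s within {0..})"
    "\<And>s. s \<ge> 0 \<Longrightarrow> D s \<ge> 0" by metis
  define W where "W = (\<lambda>s. exp (2 * \<delta> * s) * V s)"
  have W': "(W has_real_derivative - (exp (2 * \<delta> * s) * D s)) (at s within {0..})" if "s \<ge> 0" for s
  proof -
    have "((\<lambda>s. exp (2 * \<delta> * s)) has_real_derivative 2 * \<delta> * exp (2 * \<delta> * s)) (at s within {0..})"
      by (auto intro!: derivative_eq_intros)
    from DERIV_mult[OF this D(1)[OF that]] show ?thesis
      unfolding W_def by (rule DERIV_cong) (simp add: algebra_simps)
  qed
  have "W t \<le> W 0"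
  proof (rule DERIV_nonpos_imp_decreasing_open[OF t])
    fix s :: real assume s: "0 < s" "s < t"
    \<comment> \<open>Two-sided derivatives are required only in the open interval; at the endpoints
      the derivative within \<open>{0..}\<close> supplies continuity.\<close>
    have "at s within {0..} = at s" using s by (intro at_within_interior) simp
    then have "(W has_real_derivative - (exp (2 * \<delta> * s) * D s)) (at s)" using W'[of s] s by simp
    moreover have "- (exp (2 * \<delta> * s) * D s) \<le> 0" using D(2)[of s] s by simp
    ultimately show "\<exists>y. (W has_real_derivative y) (at s) \<and> y \<le> 0" by blast
  next
    show "continuous_on {0..t} W"
      unfolding continuous_on_eq_continuous_within
    proof
      fix s assume "s \<in> {0..t}"
      then show "continuous (at s within {0..t}) W"
        by (intro continuous_within_subset[OF DERIV_continuous[OF W']]) auto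
    qed
  qed
  then have "exp (2 * \<delta> * t) * V t \<le> V 0" by (simp add: W_def)
  then have "exp (- 2 * \<delta> * t) * (exp (2 * \<delta> * t) * V t) \<le> exp (- 2 * \<delta> * t) * V 0"
    by (intro mult_left_mono) auto
  then have "V t \<le> exp (- 2 * \<delta> * t) * V 0"
    by (simp add: mult.assoc[symmetric] exp_add[symmetric])
  then show ?thesis by (simp add: V_def)
qed

text \<open>The equivalence is used at time \<open>t\<close> and at time 0, with the decay of the
  functional in between.\<close>

lemma damped_system_decay:
  fixes \<alpha> \<beta> \<delta> l :: real
  assumes "\<alpha> \<ge> 0" "\<beta> \<ge> 0" "l > 0" "\<delta> > 0" "2 * \<delta> \<le> \<alpha> + \<beta> * l" "\<delta> * (\<alpha> + \<beta> * l) \<le> l"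
  shows "\<exists>C>0. \<forall>(E :: 'i set) M c d. symmetric_coercive l E M \<longrightarrow>
    (\<forall>t\<ge>0. \<forall>e\<in>E. ((\<lambda>s. c s e) has_real_derivative d t e) (at t within {0..})) \<longrightarrow>
    (\<forall>t\<ge>0. \<forall>e\<in>E. ((\<lambda>s. d s e) has_real_derivative
        - (\<beta> * mat_app E M (d t) e + \<alpha> * d t e + mat_app E M (c t) e)) (at t within {0..})) \<longrightarrow>
    (\<forall>t\<ge>0. energy_at E M (c t) (d t) \<le> C * exp (- 2 * \<delta> * t) * energy_at E M (c 0) (d 0))"
proof -
  obtain C D where CD: "C > 0" "D > 0" and equiv: "\<And>(E :: 'i set) M x y. symmetric_coercive l E M \<Longrightarrow>
    lyapunov_at \<alpha> \<beta> \<delta> E M x y \<le> C * energy_at E M x y \<and>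
    energy_at E M x y \<le> D * lyapunov_at \<alpha> \<beta> \<delta> E M x y"
    using lyapunov_at_equiv_energy_at[OF assms] by metis
  have "energy_at E M (c t) (d t) \<le> (D * C) * exp (- 2 * \<delta> * t) * energy_at E M (c 0) (d 0)"
    if M: "symmetric_coercive l E M"
      and c: "\<forall>t\<ge>0. \<forall>e\<in>E. ((\<lambda>s. c s e) has_real_derivative d t e) (at t within {0..})"
      and d: "\<forall>t\<ge>0. \<forall>e\<in>E. ((\<lambda>s. d s e) has_real_derivative
        - (\<beta> * mat_app E M (d t) e + \<alpha> * d t e + mat_app E M (c t) e)) (at t within {0..})"
      and t: "t \<ge> 0"
    for E :: "'i set" and M c d t
  proof -
    have "energy_at E M (c t) (d t) \<le> D * lyapunov_at \<alpha> \<beta> \<delta> E M (c t) (d t)"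
      using equiv[OF M] by blast
    also have "\<dots> \<le> D * (exp (- 2 * \<delta> * t) * lyapunov_at \<alpha> \<beta> \<delta> E M (c 0) (d 0))"
      by (intro mult_left_mono lyapunov_at_decay[OF assms M]) (use c d t CD in auto)
    also have "\<dots> \<le> D * (exp (- 2 * \<delta> * t) * (C * energy_at E M (c 0) (d 0)))"
      using CD equiv[OF M] by (intro mult_left_mono) auto
    finally show ?thesis by (simp add: mult_ac)
  qed
  moreover have "D * C > 0" using CD by simp
  ultimately show ?thesis by blast
qed

section \<open>Coordinates of the semidiscrete problem\<close>

text \<open>By Cauchy-Schwarz, pairing with a fixed \<open>e\<close> is Lipschitz in the L^2 norm,
  so convergence of difference quotients in L^2 passes to each coordinate.\<close>

lemma L2_inner_has_time_deriv:
  assumes deriv: "has_time_deriv \<Omega> u u'"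
    and L2: "\<And>t. t \<ge> 0 \<Longrightarrow> u t \<in> L2 \<Omega>" "\<And>t. t \<ge> 0 \<Longrightarrow> u' t \<in> L2 \<Omega>" "e \<in> L2 \<Omega>"
    and t: "t \<ge> 0"
  shows "((\<lambda>s. L2_inner \<Omega> (u s) e) has_real_derivative L2_inner \<Omega> (u' t) e) (at t within {0..})"
proof -
  let ?q = "\<lambda>s x. (u s x - u t x) / (s - t) - u' t x"
  have bound: "norm ((L2_inner \<Omega> (u s) e - L2_inner \<Omega> (u t) e) / (s - t) - L2_inner \<Omega> (u' t) e)
      \<le> norm (L2_norm \<Omega> (?q s)) * L2_norm \<Omega> e" if s: "s \<ge> 0" for s
  proof -
    let ?k = "inverse (s - t)"
    let ?d = "\<lambda>x. ?k * u s x + (- ?k) * u t x"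
    have d: "?d \<in> L2 \<Omega>" by (intro L2_lincomb L2 s t)
    \<comment> \<open>Writing the quotient with \<open>inverse\<close> keeps this identity valid at
      \<open>s = t\<close>, where division by zero gives 0.\<close>
    have q: "?q s = (\<lambda>x. 1 * ?d x + (- 1) * u' t x)"
      by (simp add: fun_eq_iff divide_inverse algebra_simps)
    have qL2: "?q s \<in> L2 \<Omega>" unfolding q by (intro L2_lincomb[OF d] L2 t)
    have "L2_inner \<Omega> (?q s) e = 1 * L2_inner \<Omega> ?d e + (- 1) * L2_inner \<Omega> (u' t) e"
      unfolding q by (intro L2_inner_lincomb_left d L2 t)
    moreover have "L2_inner \<Omega> ?d e = ?k * L2_inner \<Omega> (u s) e + (- ?k) * L2_inner \<Omega> (u t) e"
      by (intro L2_inner_lincomb_left L2 s t)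
    ultimately have "L2_inner \<Omega> (?q s) e =
        (L2_inner \<Omega> (u s) e - L2_inner \<Omega> (u t) e) / (s - t) - L2_inner \<Omega> (u' t) e"
      by (simp add: divide_inverse algebra_simps)
    with L2_Cauchy_Schwarz[OF qL2 L2(3)] show ?thesis
      by (simp add: L2_norm_nonneg)
  qed
  have "((\<lambda>s. L2_norm \<Omega> (?q s)) \<longlongrightarrow> 0) (at t within {0..})"
    using deriv t by (simp add: has_time_deriv_def)
  then have "((\<lambda>s. (L2_inner \<Omega> (u s) e - L2_inner \<Omega> (u t) e) / (s - t) - L2_inner \<Omega> (u' t) e) \<longlongrightarrow> 0)
      (at t within {0..})"
    by (rule tendsto_0_le[where K = "L2_norm \<Omega> e"])
      (use bound in \<open>auto simp: eventually_at_filter intro!: always_eventually\<close>)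
  then show ?thesis
    unfolding has_field_derivative_iff by (subst LIM_zero_iff[symmetric])
qed

section \<open>Coordinates of the Dirichlet form and of the discrete Laplacian\<close>

definition coords :: "'a::euclidean_space set \<Rightarrow> ('a \<Rightarrow> real) \<Rightarrow> ('a \<Rightarrow> real) \<Rightarrow> real" where
  "coords \<Omega> x e = L2_inner \<Omega> x e"

text \<open>A basis modulo null functions, with Parseval in place of spanning: coordinates determine
  an element of \<open>X\<close> only almost everywhere.\<close>

definition L2_basis :: "'a::euclidean_space set \<Rightarrow> ('a \<Rightarrow> real) set \<Rightarrow> ('a \<Rightarrow> real) set \<Rightarrow> bool" where
  "L2_basis \<Omega> X E \<longleftrightarrow> finite E \<and> E \<subseteq> X \<and> L2_orthonormal \<Omega> E \<and>
    (\<forall>x\<in>X. \<forall>y\<in>X. L2_inner \<Omega> x y = (\<Sum>e\<in>E. L2_inner \<Omega> x e * L2_inner \<Omega> e y))"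

lemma L2_inner_basis:
  assumes "L2_basis \<Omega> X E" "x \<in> X" "y \<in> X"
  shows "L2_inner \<Omega> x y = dot_on E (coords \<Omega> x) (coords \<Omega> y)"
  unfolding dot_on_def coords_def L2_inner_commute[of \<Omega> y] using assms by (simp add: L2_basis_def)

text \<open>The difference \<open>r\<close> between \<open>x\<close> and its expansion has zero L^2
  norm by Parseval, so \<open>dirichlet_form_null\<close> removes it from the form.\<close>

lemma dirichlet_form_basis:
  assumes \<Omega>: "bounded_domain \<Omega>" and X: "lincomb_closed X" "X \<subseteq> H1 \<Omega>"
    and E: "L2_basis \<Omega> X E" and x: "x \<in> X" and y: "y \<in> X"
  shows "dirichlet_form \<Omega> x y = (\<Sum>e\<in>E. L2_inner \<Omega> x e * dirichlet_form \<Omega> e y)"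
proof -
  have fin: "finite E" "E \<subseteq> X" using E by (auto simp: L2_basis_def)
  have X_L2: "X \<subseteq> L2 \<Omega>" using X(2) H1_imp_L2 by auto
  define s where "s = (\<lambda>z. \<Sum>e\<in>E. L2_inner \<Omega> x e * e z)"
  define r where "r = (\<lambda>z. 1 * x z + (- 1) * s z)"
  have s: "s \<in> X" unfolding s_def by (rule lincomb_closed_sum[OF X(1) fin])
  have r: "r \<in> X" using x s X(1) unfolding r_def lincomb_closed_def by blast
  have "L2_inner \<Omega> r r = 1 * L2_inner \<Omega> x r + (- 1) * L2_inner \<Omega> s r"
  proof -
    have "L2_inner \<Omega> (\<lambda>z. 1 * x z + (- 1) * s z) r = 1 * L2_inner \<Omega> x r + (- 1) * L2_inner \<Omega> s r"
      by (rule L2_inner_lincomb_left) (use x s r X_L2 in auto)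
    then show ?thesis by (simp only: r_def[symmetric])
  qed
  also have "L2_inner \<Omega> s r = (\<Sum>e\<in>E. L2_inner \<Omega> x e * L2_inner \<Omega> e r)"
    unfolding s_def using r X_L2
    by (intro linear_functional_on_sum[OF X(1) _ fin] linear_functional_L2_inner) auto
  also have "\<dots> = L2_inner \<Omega> x r"
    using E x r by (simp add: L2_basis_def)
  finally have "L2_inner \<Omega> r r = 0" by simp
  then have "dirichlet_form \<Omega> r y = 0"
    using dirichlet_form_null[OF \<Omega>] r y X(2) by auto
  moreover have "dirichlet_form \<Omega> r y = 1 * dirichlet_form \<Omega> x y + (- 1) * dirichlet_form \<Omega> s y"
    unfolding r_def by (rule dirichlet_form_lincomb_left[OF \<Omega>]) (use x s y X(2) in auto)
  moreover have "dirichlet_form \<Omega> s y = (\<Sum>e\<in>E. L2_inner \<Omega> x e * dirichlet_form \<Omega> e y)"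
    unfolding s_def using y X(2)
    by (intro linear_functional_on_sum[OF X(1) _ fin] linear_functional_dirichlet_form \<Omega>) auto
  ultimately show ?thesis by simp
qed

text \<open>The function \<open>dirichlet_form \<Omega>\<close> itself serves as the stiffness
  matrix, with basis functions as indices.\<close>

lemma mat_app_dirichlet_form:
  assumes "bounded_domain \<Omega>" "lincomb_closed X" "X \<subseteq> H1 \<Omega>" "L2_basis \<Omega> X E" "x \<in> X" "e \<in> E"
  shows "mat_app E (dirichlet_form \<Omega>) (coords \<Omega> x) e = dirichlet_form \<Omega> x e"
proof -
  have "e \<in> X" using assms(4,6) by (auto simp: L2_basis_def)
  then show ?thesis
    using dirichlet_form_basis[OF assms(1-5), of e]
    by (simp add: mat_app_def coords_def dirichlet_form_commute[of \<Omega> e] mult.commute)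
qed

lemma dot_on_mat_app_dirichlet_form:
  assumes "bounded_domain \<Omega>" "lincomb_closed X" "X \<subseteq> H1 \<Omega>" "L2_basis \<Omega> X E" "x \<in> X"
  shows "dot_on E (coords \<Omega> x) (mat_app E (dirichlet_form \<Omega>) (coords \<Omega> x)) = dirichlet_form \<Omega> x x"
proof -
  have "dot_on E (coords \<Omega> x) (mat_app E (dirichlet_form \<Omega>) (coords \<Omega> x)) =
      (\<Sum>e\<in>E. L2_inner \<Omega> x e * dirichlet_form \<Omega> e x)"
    unfolding dot_on_def using mat_app_dirichlet_form[OF assms]
    by (intro sum.cong) (auto simp: coords_def dirichlet_form_commute[of \<Omega> x])
  then show ?thesis using dirichlet_form_basis[OF assms assms(5)] by simp
qed

text \<open>The combination of basis functions with coefficients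
  \<open>dirichlet_form \<Omega> x e\<close> is a Riesz representative, so the \<open>SOME\<close>
  in the definition has a witness.\<close>

lemma discrete_laplacian_works:
  assumes "bounded_domain \<Omega>" "lincomb_closed X" "X \<subseteq> H1 \<Omega>" "L2_basis \<Omega> X E" "x \<in> X"
  shows "discrete_laplacian \<Omega> X x \<in> X \<and>
    (\<forall>v\<in>X. L2_inner \<Omega> (discrete_laplacian \<Omega> X x) v = dirichlet_form \<Omega> x v)"
proof -
  have fin: "finite E" "E \<subseteq> X" using assms(4) by (auto simp: L2_basis_def)
  let ?z = "\<lambda>y. \<Sum>e\<in>E. dirichlet_form \<Omega> x e * e y"
  have z: "?z \<in> X" by (rule lincomb_closed_sum[OF assms(2) fin])
  have X_L2: "X \<subseteq> L2 \<Omega>" using assms(3) H1_imp_L2 by auto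
  have "L2_inner \<Omega> ?z v = dirichlet_form \<Omega> x v" if v: "v \<in> X" for v
  proof -
    have "L2_inner \<Omega> ?z v = (\<Sum>e\<in>E. dirichlet_form \<Omega> x e * L2_inner \<Omega> e v)"
      using v X_L2 by (intro linear_functional_on_sum[OF assms(2) _ fin] linear_functional_L2_inner) auto
    also have "\<dots> = (\<Sum>e\<in>E. L2_inner \<Omega> v e * dirichlet_form \<Omega> e x)"
      by (intro sum.cong) (auto simp: dirichlet_form_commute[of \<Omega> x] L2_inner_commute[of \<Omega> v])
    also have "\<dots> = dirichlet_form \<Omega> x v"
      using dirichlet_form_basis[OF assms(1-4) v assms(5)] by (simp add: dirichlet_form_commute[of \<Omega> x])
    finally show ?thesis .
  qed
  with z have "?z \<in> X \<and> (\<forall>v\<in>X. L2_inner \<Omega> ?z v = dirichlet_form \<Omega> x v)" by blast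
  then show ?thesis unfolding discrete_laplacian_def
    by (rule someI[where P = "\<lambda>z. z \<in> X \<and> (\<forall>v\<in>X. L2_inner \<Omega> z v = dirichlet_form \<Omega> x v)"])
qed

text \<open>The coordinates of the discrete Laplacian of \<open>u t\<close> are the entries of the
  stiffness matrix applied to those of \<open>u t\<close>; Parseval does the rest.\<close>

lemma discrete_energy_eq_energy_at:
  assumes "bounded_domain \<Omega>" "lincomb_closed X" "X \<subseteq> H1 \<Omega>" "L2_basis \<Omega> X E" "u t \<in> X" "u' t \<in> X"
  shows "discrete_energy \<Omega> X u u' t =
    energy_at E (dirichlet_form \<Omega>) (coords \<Omega> (u t)) (coords \<Omega> (u' t)) / 2"
proof -
  let ?z = "discrete_laplacian \<Omega> X (u t)"
  have z: "?z \<in> X" "\<And>v. v \<in> X \<Longrightarrow> L2_inner \<Omega> ?z v = dirichlet_form \<Omega> (u t) v"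
    using discrete_laplacian_works[OF assms(1-5)] by auto
  have "(discrete_H2_norm \<Omega> X (u t))\<^sup>2 = dot_on E (coords \<Omega> ?z) (coords \<Omega> ?z)"
    using L2_inner_basis[OF assms(4) z(1) z(1)] by (simp add: discrete_H2_norm_def L2_norm_squared)
  also have "\<dots> = dot_on E (mat_app E (dirichlet_form \<Omega>) (coords \<Omega> (u t)))
      (mat_app E (dirichlet_form \<Omega>) (coords \<Omega> (u t)))"
    unfolding dot_on_def using assms(4) z(2) mat_app_dirichlet_form[OF assms(1-5)]
    by (intro sum.cong) (auto simp: coords_def L2_basis_def subset_eq)
  finally show ?thesis
    using dot_on_mat_app_dirichlet_form[OF assms(1-4,6)]
    by (simp add: discrete_energy_def energy_at_def energy_norm_def dirichlet_form_nonneg)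
qed

lemma mat_app_cong: "(\<And>e. e \<in> E \<Longrightarrow> x e = y e) \<Longrightarrow> mat_app E M x = mat_app E M y"
  by (simp add: mat_app_def fun_eq_iff)

lemma dot_on_cong:
  "(\<And>e. e \<in> E \<Longrightarrow> x e = x' e) \<Longrightarrow> (\<And>e. e \<in> E \<Longrightarrow> y e = y' e) \<Longrightarrow> dot_on E x y = dot_on E x' y'"
  by (simp add: dot_on_def)

text \<open>Every coordinate vector agrees on \<open>E\<close> with the coordinates of some
  \<open>w\<close> in \<open>X\<close>, to which the Poincare inequality applies.\<close>

lemma symmetric_coercive_dirichlet_form:
  assumes "bounded_domain \<Omega>" "lincomb_closed X" "X \<subseteq> H1 \<Omega>" "L2_basis \<Omega> X E" "l > 0"
    and poincare: "\<And>v. v \<in> X \<Longrightarrow> (L2_norm \<Omega> v)\<^sup>2 \<le> inverse l * (energy_norm \<Omega> v)\<^sup>2"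
  shows "symmetric_coercive l E (dirichlet_form \<Omega>)"
  unfolding symmetric_coercive_def
proof (intro conjI ballI allI)
  show "dirichlet_form \<Omega> e f = dirichlet_form \<Omega> f e" for e f
    by (rule dirichlet_form_commute)
  fix x :: "('a \<Rightarrow> real) \<Rightarrow> real"
  have fin: "finite E" "E \<subseteq> X" using assms(4) by (auto simp: L2_basis_def)
  have X_L2: "X \<subseteq> L2 \<Omega>" using assms(3) H1_imp_L2 by auto
  define w where "w = (\<lambda>z. \<Sum>e\<in>E. x e * e z)"
  have w: "w \<in> X" unfolding w_def by (rule lincomb_closed_sum[OF assms(2) fin])
  have co: "coords \<Omega> w e = x e" if e: "e \<in> E" for e
  proof -
    have "coords \<Omega> w e = (\<Sum>f\<in>E. x f * L2_inner \<Omega> f e)"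
      unfolding coords_def w_def using e fin X_L2
      by (intro linear_functional_on_sum[OF assms(2) _ fin] linear_functional_L2_inner) auto
    also have "\<dots> = (\<Sum>f\<in>E. if f = e then x f else 0)"
      using assms(4) e by (intro sum.cong) (auto simp: L2_basis_def L2_orthonormal_def)
    finally show ?thesis using fin e by simp
  qed
  have "l * L2_inner \<Omega> w w \<le> dirichlet_form \<Omega> w w"
    using poincare[OF w] \<open>l > 0\<close>
    by (simp add: L2_norm_squared energy_norm_def dirichlet_form_nonneg field_simps)
  moreover have "L2_inner \<Omega> w w = dot_on E x x"
    unfolding L2_inner_basis[OF assms(4) w w] by (intro dot_on_cong co)
  moreover have "dirichlet_form \<Omega> w w = dot_on E x (mat_app E (dirichlet_form \<Omega>) x)"
  proof -
    have "mat_app E (dirichlet_form \<Omega>) (coords \<Omega> w) = mat_app E (dirichlet_form \<Omega>) x"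
      by (intro mat_app_cong co)
    then show ?thesis
      unfolding dot_on_mat_app_dirichlet_form[OF assms(1-4) w, symmetric]
      by (auto intro: dot_on_cong co)
  qed
  ultimately show "l * dot_on E x x \<le> dot_on E x (mat_app E (dirichlet_form \<Omega>) x)" by simp
qed

section \<open>Energy decay for the semidiscrete problem\<close>

text \<open>Testing the equation with the basis functions turns it into the damped system for the
  coordinates of \<open>u\<close> and \<open>u'\<close>. The constant is chosen before the domain
  and the space.\<close>

lemma semidiscrete_energy_decay:
  fixes \<alpha> \<beta> \<delta> l :: real
  assumes "\<alpha> \<ge> 0" "\<beta> \<ge> 0" "l > 0" "\<delta> > 0" "2 * \<delta> \<le> \<alpha> + \<beta> * l" "\<delta> * (\<alpha> + \<beta> * l) \<le> l"
  shows "\<exists>C>0. \<forall>(\<Omega> :: 'a::euclidean_space set) X u0 u1 u u'. bounded_domain \<Omega> \<longrightarrow>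
    (\<forall>v\<in>H10 \<Omega>. (L2_norm \<Omega> v)\<^sup>2 \<le> inverse l * (energy_norm \<Omega> v)\<^sup>2) \<longrightarrow>
    finite_dim_subspace X \<longrightarrow> X \<subseteq> H10 \<Omega> \<longrightarrow> semidiscrete_solution \<Omega> \<alpha> \<beta> X u0 u1 u u' \<longrightarrow>
    (\<forall>t\<ge>0. discrete_energy \<Omega> X u u' t \<le> C * exp (- 2 * \<delta> * t) * discrete_energy \<Omega> X u u' 0)"
proof -
  obtain C where "C > 0" and C: "\<And>(E :: ('a \<Rightarrow> real) set) M c d t. symmetric_coercive l E M \<Longrightarrow>
    (\<forall>t\<ge>0. \<forall>e\<in>E. ((\<lambda>s. c s e) has_real_derivative d t e) (at t within {0..})) \<Longrightarrow>
    (\<forall>t\<ge>0. \<forall>e\<in>E. ((\<lambda>s. d s e) has_real_derivative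
        - (\<beta> * mat_app E M (d t) e + \<alpha> * d t e + mat_app E M (c t) e)) (at t within {0..})) \<Longrightarrow>
    t \<ge> 0 \<Longrightarrow> energy_at E M (c t) (d t) \<le> C * exp (- 2 * \<delta> * t) * energy_at E M (c 0) (d 0)"
    using damped_system_decay[OF assms] by metis
  have "discrete_energy \<Omega> X u u' t \<le> C * exp (- 2 * \<delta> * t) * discrete_energy \<Omega> X u u' 0"
    if \<Omega>: "bounded_domain \<Omega>" and poincare: "\<forall>v\<in>H10 \<Omega>. (L2_norm \<Omega> v)\<^sup>2 \<le> inverse l * (energy_norm \<Omega> v)\<^sup>2"
      and X: "finite_dim_subspace X" "X \<subseteq> H10 \<Omega>" and sol: "semidiscrete_solution \<Omega> \<alpha> \<beta> X u0 u1 u u'"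
      and t: "t \<ge> 0"
    for \<Omega> :: "'a set" and X u0 u1 u u' t
  proof -
    have cl: "lincomb_closed X" using X(1) by (rule finite_dim_subspace_lincomb_closed)
    have X_H1: "X \<subseteq> H1 \<Omega>" using X(2) by (auto simp: H10_def)
    then have X_L2: "X \<subseteq> L2 \<Omega>" using H1_imp_L2 by auto
    obtain E where E: "L2_basis \<Omega> X E"
      using L2_orthonormal_basis_exists[OF X(1) X_L2] by (auto simp: L2_basis_def)
    note ctx = \<Omega> cl X_H1 E
    obtain u'' where u: "\<And>t. t \<ge> 0 \<Longrightarrow> u t \<in> X" "\<And>t. t \<ge> 0 \<Longrightarrow> u' t \<in> X" "\<And>t. t \<ge> 0 \<Longrightarrow> u'' t \<in> X"
      and der: "has_time_deriv \<Omega> u u'" "has_time_deriv \<Omega> u' u''"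
      and eq: "\<And>t v. t \<ge> 0 \<Longrightarrow> v \<in> X \<Longrightarrow> L2_inner \<Omega> (u'' t) v + \<beta> * dirichlet_form \<Omega> (u' t) v
           + \<alpha> * L2_inner \<Omega> (u' t) v + dirichlet_form \<Omega> (u t) v = 0"
      using sol unfolding semidiscrete_solution_def by blast
    note E_X = E[unfolded L2_basis_def, THEN conjunct2, THEN conjunct1]
    have coer: "symmetric_coercive l E (dirichlet_form \<Omega>)"
      by (rule symmetric_coercive_dirichlet_form[OF ctx \<open>l > 0\<close>]) (use poincare X(2) in auto)
    have c_der: "\<forall>t\<ge>0. \<forall>e\<in>E. ((\<lambda>s. coords \<Omega> (u s) e) has_real_derivative coords \<Omega> (u' t) e) (at t within {0..})"
      unfolding coords_def using u X_L2 E_X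
      by (intro allI impI ballI L2_inner_has_time_deriv[OF der(1)]) auto
    have d_der: "\<forall>t\<ge>0. \<forall>e\<in>E. ((\<lambda>s. coords \<Omega> (u' s) e) has_real_derivative
        - (\<beta> * mat_app E (dirichlet_form \<Omega>) (coords \<Omega> (u' t)) e + \<alpha> * coords \<Omega> (u' t) e
          + mat_app E (dirichlet_form \<Omega>) (coords \<Omega> (u t)) e)) (at t within {0..})"
    proof (intro allI impI ballI)
      fix t :: real and e assume t: "0 \<le> t" and e: "e \<in> E"
      have "((\<lambda>s. coords \<Omega> (u' s) e) has_real_derivative L2_inner \<Omega> (u'' t) e) (at t within {0..})"
        unfolding coords_def using u X_L2 E_X e
        by (intro L2_inner_has_time_deriv[OF der(2) _ _ _ t]) auto
      moreover have "L2_inner \<Omega> (u'' t) e = - (\<beta> * mat_app E (dirichlet_form \<Omega>) (coords \<Omega> (u' t)) e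
          + \<alpha> * coords \<Omega> (u' t) e + mat_app E (dirichlet_form \<Omega>) (coords \<Omega> (u t)) e)"
        using eq[OF t, of e] e E_X u[OF t]
        by (auto simp: mat_app_dirichlet_form[OF ctx _ e] coords_def)
      ultimately show "((\<lambda>s. coords \<Omega> (u' s) e) has_real_derivative
        - (\<beta> * mat_app E (dirichlet_form \<Omega>) (coords \<Omega> (u' t)) e + \<alpha> * coords \<Omega> (u' t) e
          + mat_app E (dirichlet_form \<Omega>) (coords \<Omega> (u t)) e)) (at t within {0..})" by simp
    qed
    have "energy_at E (dirichlet_form \<Omega>) (coords \<Omega> (u s)) (coords \<Omega> (u' s)) =
        2 * discrete_energy \<Omega> X u u' s" if "s \<ge> 0" for s
      using discrete_energy_eq_energy_at[OF ctx, of u s u'] u that by simp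
    then show ?thesis
      using C[OF coer c_der d_der t] t by simp
  qed
  with \<open>C > 0\<close> show ?thesis by blast
qed

theorem theorem3p3:
  fixes \<alpha> \<beta> l1 :: real
  assumes damping: "(\<alpha> > 0 \<and> \<beta> \<ge> 0) \<or> (\<alpha> \<ge> 0 \<and> \<beta> > 0)"
    and l1_pos: "l1 > 0"
  shows
    "(\<exists>C>0. \<forall>(\<Omega> :: 'a::euclidean_space set) \<sigma> c h X u0 u1 u u' \<delta>.
        bounded_domain \<Omega> \<longrightarrow>
        smallest_dirichlet_eigenvalue \<Omega> l1 \<longrightarrow>
        (\<forall>v \<in> H10 \<Omega>. (L2_norm \<Omega> v)\<^sup>2 \<le> inverse l1 * (energy_norm \<Omega> v)\<^sup>2) \<longrightarrow>
        finite_element_space \<Omega> \<sigma> c h X \<longrightarrow>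
        u0 \<in> X \<longrightarrow> u1 \<in> X \<longrightarrow>
        semidiscrete_solution \<Omega> \<alpha> \<beta> X u0 u1 u u' \<longrightarrow>
        0 < \<delta> \<longrightarrow> \<delta> \<le> min ((\<alpha> + \<beta> * l1) / 2) (l1 / (\<alpha> + \<beta> * l1)) \<longrightarrow>
        \<delta> < min ((\<alpha> + \<beta> * l1) / 2) (l1 / (\<alpha> + \<beta> * l1)) \<or> \<delta> = (\<alpha> + \<beta> * l1) / 2 \<longrightarrow>
        (\<forall>t\<ge>0. discrete_energy \<Omega> X u u' t \<le> C * exp (- 2 * \<delta> * t) * discrete_energy \<Omega> X u u' 0))
   \<and> (\<exists>C>0. \<forall>(\<Omega> :: 'a set) \<sigma> c h X u0 u1 u u' \<delta>.
        bounded_domain \<Omega> \<longrightarrow>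
        smallest_dirichlet_eigenvalue \<Omega> l1 \<longrightarrow>
        (\<forall>v \<in> H10 \<Omega>. (L2_norm \<Omega> v)\<^sup>2 \<le> inverse l1 * (energy_norm \<Omega> v)\<^sup>2) \<longrightarrow>
        finite_element_space \<Omega> \<sigma> c h X \<longrightarrow>
        u0 \<in> X \<longrightarrow> u1 \<in> X \<longrightarrow>
        semidiscrete_solution \<Omega> \<alpha> \<beta> X u0 u1 u u' \<longrightarrow>
        0 < \<delta> \<longrightarrow> \<delta> \<le> min ((\<alpha> + \<beta> * l1) / 2) (l1 / (\<alpha> + \<beta> * l1)) \<longrightarrow>
        \<delta> = l1 / (\<alpha> + \<beta> * l1) \<longrightarrow>
        (\<forall>t\<ge>0. (energy_norm \<Omega> (u' t))\<^sup>2 \<le> C * exp (- 2 * \<delta> * t) * discrete_energy \<Omega> X u u' 0))"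
proof -
  define m where "m = min ((\<alpha> + \<beta> * l1) / 2) (l1 / (\<alpha> + \<beta> * l1))"
  have nonneg: "\<alpha> \<ge> 0" "\<beta> \<ge> 0" using damping by auto
  have b: "\<alpha> + \<beta> * l1 > 0"
    using damping l1_pos by (auto intro: add_pos_nonneg add_nonneg_pos)
  have m: "m > 0" "2 * m \<le> \<alpha> + \<beta> * l1" "m * (\<alpha> + \<beta> * l1) \<le> l1"
  proof -
    show "m > 0" using b l1_pos by (simp add: m_def)
    have "m \<le> (\<alpha> + \<beta> * l1) / 2" unfolding m_def by (rule min.cobounded1)
    then show "2 * m \<le> \<alpha> + \<beta> * l1" by simp
    have "m \<le> l1 / (\<alpha> + \<beta> * l1)" unfolding m_def by (rule min.cobounded2)
    then show "m * (\<alpha> + \<beta> * l1) \<le> l1" using b by (simp add: pos_le_divide_eq)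
  qed
  \<comment> \<open>The constant belongs to the extreme rate \<open>m\<close>, so it can stand
    before the quantifier over \<open>\<delta>\<close>.\<close>
  obtain C where "C > 0" and C: "\<And>(\<Omega> :: 'a set) X u0 u1 u u' t. bounded_domain \<Omega> \<Longrightarrow>
    (\<forall>v\<in>H10 \<Omega>. (L2_norm \<Omega> v)\<^sup>2 \<le> inverse l1 * (energy_norm \<Omega> v)\<^sup>2) \<Longrightarrow>
    finite_dim_subspace X \<Longrightarrow> X \<subseteq> H10 \<Omega> \<Longrightarrow> semidiscrete_solution \<Omega> \<alpha> \<beta> X u0 u1 u u' \<Longrightarrow> t \<ge> 0 \<Longrightarrow>
    discrete_energy \<Omega> X u u' t \<le> C * exp (- 2 * m * t) * discrete_energy \<Omega> X u u' 0"
    using semidiscrete_energy_decay[OF nonneg l1_pos m, where ?'a = 'a] by metis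
  have decay: "discrete_energy \<Omega> X u u' t \<le> C * exp (- 2 * \<delta> * t) * discrete_energy \<Omega> X u u' 0"
    if "bounded_domain \<Omega>" "\<forall>v\<in>H10 \<Omega>. (L2_norm \<Omega> v)\<^sup>2 \<le> inverse l1 * (energy_norm \<Omega> v)\<^sup>2"
      and "finite_element_space \<Omega> \<sigma> c h X" "semidiscrete_solution \<Omega> \<alpha> \<beta> X u0 u1 u u'"
      and \<delta>: "\<delta> \<le> m" and t: "t \<ge> 0"
    for \<Omega> :: "'a set" and \<sigma> c h X u0 u1 u u' \<delta> t
  proof -
    have "finite_dim_subspace X" "X \<subseteq> H10 \<Omega>"
      using that(3) by (auto simp: finite_element_space_def)
    then have "discrete_energy \<Omega> X u u' t \<le> C * exp (- 2 * m * t) * discrete_energy \<Omega> X u u' 0"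
      using C that by blast
    also have "\<dots> \<le> C * exp (- 2 * \<delta> * t) * discrete_energy \<Omega> X u u' 0"
      using \<open>C > 0\<close> \<delta> t
      by (intro mult_right_mono mult_left_mono) (auto simp: discrete_energy_def mult_right_mono)
    finally show ?thesis .
  qed
  \<comment> \<open>The factor 1/2 in the energy is the source of the constant \<open>2 * C\<close>
    in the second part.\<close>
  have energy_le: "(energy_norm \<Omega> (u' t))\<^sup>2 \<le> 2 * discrete_energy \<Omega> X u u' t" for \<Omega> :: "'a set" and X u u' t
    by (simp add: discrete_energy_def)
  show ?thesis
  proof (rule conjI)
    show "\<exists>C>0. \<forall>(\<Omega> :: 'a set) \<sigma> c h X u0 u1 u u' \<delta>.
        bounded_domain \<Omega> \<longrightarrow>
        smallest_dirichlet_eigenvalue \<Omega> l1 \<longrightarrow>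
        (\<forall>v \<in> H10 \<Omega>. (L2_norm \<Omega> v)\<^sup>2 \<le> inverse l1 * (energy_norm \<Omega> v)\<^sup>2) \<longrightarrow>
        finite_element_space \<Omega> \<sigma> c h X \<longrightarrow>
        u0 \<in> X \<longrightarrow> u1 \<in> X \<longrightarrow>
        semidiscrete_solution \<Omega> \<alpha> \<beta> X u0 u1 u u' \<longrightarrow>
        0 < \<delta> \<longrightarrow> \<delta> \<le> min ((\<alpha> + \<beta> * l1) / 2) (l1 / (\<alpha> + \<beta> * l1)) \<longrightarrow>
        \<delta> < min ((\<alpha> + \<beta> * l1) / 2) (l1 / (\<alpha> + \<beta> * l1)) \<or> \<delta> = (\<alpha> + \<beta> * l1) / 2 \<longrightarrow>
        (\<forall>t\<ge>0. discrete_energy \<Omega> X u u' t \<le> C * exp (- 2 * \<delta> * t) * discrete_energy \<Omega> X u u' 0)"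
      by (rule exI[of _ C], rule conjI[OF \<open>C > 0\<close>], fold m_def, intro allI impI) (rule decay)
    show "\<exists>C>0. \<forall>(\<Omega> :: 'a set) \<sigma> c h X u0 u1 u u' \<delta>.
        bounded_domain \<Omega> \<longrightarrow>
        smallest_dirichlet_eigenvalue \<Omega> l1 \<longrightarrow>
        (\<forall>v \<in> H10 \<Omega>. (L2_norm \<Omega> v)\<^sup>2 \<le> inverse l1 * (energy_norm \<Omega> v)\<^sup>2) \<longrightarrow>
        finite_element_space \<Omega> \<sigma> c h X \<longrightarrow>
        u0 \<in> X \<longrightarrow> u1 \<in> X \<longrightarrow>
        semidiscrete_solution \<Omega> \<alpha> \<beta> X u0 u1 u u' \<longrightarrow>
        0 < \<delta> \<longrightarrow> \<delta> \<le> min ((\<alpha> + \<beta> * l1) / 2) (l1 / (\<alpha> + \<beta> * l1)) \<longrightarrow>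
        \<delta> = l1 / (\<alpha> + \<beta> * l1) \<longrightarrow>
        (\<forall>t\<ge>0. (energy_norm \<Omega> (u' t))\<^sup>2 \<le> C * exp (- 2 * \<delta> * t) * discrete_energy \<Omega> X u u' 0)"
    proof (rule exI[of _ "2 * C"], rule conjI, goal_cases)
      case 1
      show ?case using \<open>C > 0\<close> by simp
    next
      case 2
      show ?case
      proof (fold m_def, intro allI impI)
        fix \<Omega> :: "'a set" and \<sigma> c h X u0 u1 u u' \<delta> and t :: real
        assume "bounded_domain \<Omega>" "\<forall>v\<in>H10 \<Omega>. (L2_norm \<Omega> v)\<^sup>2 \<le> inverse l1 * (energy_norm \<Omega> v)\<^sup>2"
          "finite_element_space \<Omega> \<sigma> c h X" "semidiscrete_solution \<Omega> \<alpha> \<beta> X u0 u1 u u'" "\<delta> \<le> m" "t \<ge> 0"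
        from decay[OF this] energy_le[of \<Omega> u' t X u]
        show "(energy_norm \<Omega> (u' t))\<^sup>2 \<le> 2 * C * exp (- 2 * \<delta> * t) * discrete_energy \<Omega> X u u' 0" by simp
      qed
    qed
  qed
qed

end
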